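(* Let $A:=A_1\times A_2$ be a linear automorphism of the torus $\mathbb{T}^4=\mathbb{T}^2\times\mathbb{T}^2$ that is the direct product of two linear hyperbolic automorphisms $A_1,A_2$ of $\mathbb{T}^2$. Then there exist $A$-invariant ergodic Borel probability measures $\mu$ with positive entropy such that for $\mu$-almost every $x$ $$\lim_{r\to0}\frac{\tau(B(x,r))}{-\log r}=\frac{1}{\Lambda^u}-\frac{1}{\Lambda^s}.$$
   Context: $B(x,r)$ is the ball of radius $r$ around $x$ in $\mathbb{T}^4$ for the usual (flat) metric. For a set $E\subset\mathbb{T}^4$, $\tau(E):=\min\{k>0: A^k(E)\cap E\neq\emptyset\}$. $\Lambda^u$ is the largest and $\Lambda^s$ the smallest (most negative) Lyapunov exponent of $A$ (with respect to $\mu$; the Lyapunov exponents are the logarithms of the moduli of the eigenvalues of $A$). *)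

theory Defs
  imports "HOL-Analysis.Analysis" "HOL-Probability.Probability"
begin

section \<open>Flat tori\<close>

quotient_type (overloaded) 'n torus =
  "real^('n::finite)" / "\<lambda>x y. \<forall>i. x $ i - y $ i \<in> \<int>"
proof (rule equivpI)
  show "reflp (\<lambda>x y::real^'n. \<forall>i. x $ i - y $ i \<in> \<int>)"
    by (auto simp: reflp_def)
  show "symp (\<lambda>x y::real^'n. \<forall>i. x $ i - y $ i \<in> \<int>)"
    unfolding symp_def by (metis Ints_minus minus_diff_eq)
  show "transp (\<lambda>x y::real^'n. \<forall>i. x $ i - y $ i \<in> \<int>)"
    unfolding transp_def by (metis Ints_add diff_add_cancel add_diff_eq)
qed

abbreviation torus_fibre :: "('n::finite) torus \<Rightarrow> (real^'n) set" where
  "torus_fibre X \<equiv> {x. abs_torus x = X}"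

lemma abs_torus_eq_iff:
  "abs_torus x = abs_torus y \<longleftrightarrow> (\<forall>i. x $ i - y $ i \<in> \<int>)"
  by (rule torus.abs_eq_iff)

lemma ex_abs_torus [simp]: "\<exists>x. abs_torus x = X"
  using Quotient_abs_rep[OF Quotient_torus] by blast

lemma torus_fibre_nonempty: "torus_fibre X \<noteq> {}"
  by simp

lemma closed_torus_fibre: "closed (torus_fibre X)"
proof -
  obtain y where "X = abs_torus y"
    using torus_fibre_nonempty[of X] by blast
  then have "torus_fibre X = (\<Inter>i. (\<lambda>x. x $ i - y $ i) -` \<int>)"
    by (auto simp: abs_torus_eq_iff)
  moreover have "closed ((\<lambda>x. x $ i - y $ i) -` (\<int> :: real set))" for i
    by (intro closed_vimage closed_Ints continuous_intros)
  ultimately show ?thesis by (auto intro: closed_INT)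
qed

lemma setdist_torus_fibre:
  assumes "abs_torus x = X"
  shows "setdist (torus_fibre X) (torus_fibre Y) = setdist {x} (torus_fibre Y)"
proof (rule antisym)
  show "setdist (torus_fibre X) (torus_fibre Y) \<le> setdist {x} (torus_fibre Y)"
    using assms by (intro setdist_le_sing) auto
  show "setdist {x} (torus_fibre Y) \<le> setdist (torus_fibre X) (torus_fibre Y)"
  proof (rule le_setdistI)
    fix x' y assume x': "x' \<in> torus_fibre X" and y: "y \<in> torus_fibre Y"
    have "\<forall>i. x $ i - x' $ i \<in> \<int>"
      using x' assms by (simp flip: abs_torus_eq_iff)
    then have "y + (x - x') \<in> torus_fibre Y"
      using y by (auto simp: abs_torus_eq_iff)
    then have "setdist {x} (torus_fibre Y) \<le> dist x (y + (x - x'))"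
      by (intro setdist_le_dist) auto
    also have "\<dots> = dist x' y" by (simp add: dist_norm)
    finally show "setdist {x} (torus_fibre Y) \<le> dist x' y" .
  qed auto
qed

text \<open>The flat metric. On a product of tori, the Euclidean product metric provided by the
  instance for \<open>prod\<close> is again the flat metric.\<close>

instantiation torus :: (finite) metric_space
begin

definition dist_torus :: "'a torus \<Rightarrow> 'a torus \<Rightarrow> real" where
  "dist_torus X Y = setdist (torus_fibre X) (torus_fibre Y)"

definition uniformity_torus :: "('a torus \<times> 'a torus) filter" where
  "uniformity_torus = (INF e\<in>{0<..}. principal {(x, y). dist x y < e})"

definition open_torus :: "'a torus set \<Rightarrow> bool" where
  "open_torus U \<longleftrightarrow> (\<forall>x\<in>U. \<forall>\<^sub>F (x', y) in uniformity. x' = x \<longrightarrow> y \<in> U)"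

instance
proof
  fix X Y Z :: "'a torus"
  obtain x where x: "abs_torus x = X" using torus_fibre_nonempty[of X] by blast
  obtain z where z: "abs_torus z = Z" using torus_fibre_nonempty[of Z] by blast
  show "dist X Y = 0 \<longleftrightarrow> X = Y"
    using closed_torus_fibre[of Y] torus_fibre_nonempty[of Y] x
    by (simp add: dist_torus_def setdist_torus_fibre[OF x] setdist_eq_0_closed
        del: ex_abs_torus) (metis ex_abs_torus)
  have "setdist {z} (torus_fibre X) = setdist (torus_fibre X) (torus_fibre Z)"
    using setdist_torus_fibre[OF z] by (simp add: setdist_sym)
  moreover have "setdist (torus_fibre X) {z} = setdist {z} (torus_fibre X)"
    by (rule setdist_sym)
  ultimately show "dist X Y \<le> dist X Z + dist Y Z"
    using setdist_triangle[of "torus_fibre X" "torus_fibre Y" z] setdist_torus_fibre[OF z]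
    by (simp add: dist_torus_def setdist_sym)
qed (simp_all add: uniformity_torus_def open_torus_def)

end


section \<open>Linear automorphisms and Lyapunov exponents\<close>

lift_definition torus_map :: "int^'n^'n \<Rightarrow> ('n::finite) torus \<Rightarrow> 'n torus"
  is "\<lambda>M x. map_matrix real_of_int M *v x"
  by (auto simp: matrix_vector_mult_def simp flip: sum_subtractf right_diff_distrib
      intro!: Ints_sum Ints_mult)

definition eigenvalues :: "int^'n^'n \<Rightarrow> complex set" where
  "eigenvalues M = {z. \<exists>v. v \<noteq> 0 \<and> map_matrix complex_of_int M *v v = z *s v}"

text \<open>Over the integers, \<^const>\<open>invertible\<close> means having an integral inverse, i.e. being in
  $GL_n(\mathbb{Z})$; this makes \<^const>\<open>torus_map\<close> an automorphism.\<close>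

definition hyperbolic :: "int^'n^'n \<Rightarrow> bool" where
  "hyperbolic M \<longleftrightarrow> invertible M \<and> (\<forall>z\<in>eigenvalues M. cmod z \<noteq> 1)"

text \<open>The matrix inducing a direct product of two toral automorphisms, so that its eigenvalues
  are those of the product.\<close>

definition block_diag :: "int^'n^'n \<Rightarrow> int^'m^'m \<Rightarrow> int^('n + 'm)^('n + 'm)" where
  "block_diag M N = (\<chi> i j. case (i, j) of
     (Inl a, Inl b) \<Rightarrow> M $ a $ b
   | (Inr a, Inr b) \<Rightarrow> N $ a $ b
   | _ \<Rightarrow> 0)"

definition lyapunov_exponents :: "int^'n^'n \<Rightarrow> real set" where
  "lyapunov_exponents M = (\<lambda>z. ln (cmod z)) ` eigenvalues M"

definition lyapunov_max :: "int^'n^'n \<Rightarrow> real" where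
  "lyapunov_max M = Max (lyapunov_exponents M)"

definition lyapunov_min :: "int^'n^'n \<Rightarrow> real" where
  "lyapunov_min M = Min (lyapunov_exponents M)"


section \<open>Invariance, ergodicity, entropy\<close>

definition invariant_measure :: "'a measure \<Rightarrow> ('a \<Rightarrow> 'a) \<Rightarrow> bool" where
  "invariant_measure M T \<longleftrightarrow> T \<in> measurable M M \<and> distr M M T = M"

definition ergodic_measure :: "'a measure \<Rightarrow> ('a \<Rightarrow> 'a) \<Rightarrow> bool" where
  "ergodic_measure M T \<longleftrightarrow> invariant_measure M T \<and>
     (\<forall>E\<in>sets M. T -` E \<inter> space M = E \<longrightarrow> measure M E = 0 \<or> measure M E = 1)"

definition finite_partitions :: "'a measure \<Rightarrow> 'a set set set" where
  "finite_partitions M = {P. finite P \<and> P \<subseteq> sets M \<and> partition_on (space M) P}"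

text \<open>The convention $0 \log 0 = 0$ holds automatically.\<close>

definition partition_entropy :: "'a measure \<Rightarrow> 'a set set \<Rightarrow> real" where
  "partition_entropy M P = - (\<Sum>C\<in>P. measure M C * ln (measure M C))"

text \<open>The join $P \vee T^{-1}P \vee \dots \vee T^{-(n-1)}P$ (for $n > 0$).\<close>

definition iterated_join :: "'a measure \<Rightarrow> ('a \<Rightarrow> 'a) \<Rightarrow> 'a set set \<Rightarrow> nat \<Rightarrow> 'a set set" where
  "iterated_join M T P n =
     common_refinement ((\<lambda>i. (\<lambda>C. (T ^^ i) -` C \<inter> space M) ` P) ` {..<n})"

text \<open>Kolmogorov--Sinai entropy. For invariant probability measures, the sequence
  \<open>partition_entropy M (iterated_join M T P n)\<close> is subadditive in \<open>n\<close>, so the upper limit is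
  the usual limit.\<close>

definition ks_entropy_partition :: "'a measure \<Rightarrow> ('a \<Rightarrow> 'a) \<Rightarrow> 'a set set \<Rightarrow> ereal" where
  "ks_entropy_partition M T P =
     limsup (\<lambda>n. ereal (partition_entropy M (iterated_join M T P n) / real n))"

definition ks_entropy :: "'a measure \<Rightarrow> ('a \<Rightarrow> 'a) \<Rightarrow> ereal" where
  "ks_entropy M T = (SUP P\<in>finite_partitions M. ks_entropy_partition M T P)"


section \<open>Return times of sets\<close>

text \<open>If \<open>E\<close> never meets its forward images, this \<^const>\<open>Inf\<close> is \<open>0\<close> by convention. For balls
  under toral automorphisms this case does not occur, by Poincar\'e recurrence for the
  Haar measure.\<close>

definition return_time :: "('a \<Rightarrow> 'a) \<Rightarrow> 'a set \<Rightarrow> nat" where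
  "return_time T E = Inf {k. k > 0 \<and> (T ^^ k) ` E \<inter> E \<noteq> {}}"

end

theory Submission
  imports Defs
begin

text \<open>
  Let \<open>h\<^sub>i = ln \<Lambda>\<^sub>i > 0\<close> be the positive exponent of \<open>A\<^sub>i\<close>; the exponents of the product are
  \<open>\<plusminus> h\<^sub>1\<close> and \<open>\<plusminus> h\<^sub>2\<close>, so the asserted limit is \<open>2 / max h\<^sub>1 h\<^sub>2\<close>. Let \<open>A\<^sub>i\<close> be a factor with the
  larger exponent \<open>ln \<Lambda>\<close>. The measure is Haar measure on that factor times the point mass at the
  fixed point \<open>0\<close> of the other one. A ball around a point of the slice projects onto, and contains a
  copy of, the ball of the same radius in the 2-torus, so it has the same return times, and the
  problem reduces to Haar measure for one hyperbolic automorphism \<open>f\<close> of the 2-torus. The argument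
  is carried out for lifts to the plane, with Lebesgue measure on the unit cube and
  \<open>\<int>\<^sup>n\<close>-periodic sets.

  Haar measure is preserved by every surjective endomorphism, because the image measure is
  translation invariant and Fubini's theorem identifies it with Haar measure
  (\<open>cube_measure_endomorphism\<close>).

  Ergodicity (\<open>ergodic_cube_measure\<close>): for an invariant set \<open>F\<close>, the measure of
  \<open>F - (F - v)\<close> does not change when \<open>v\<close> is replaced by \<open>f\<^sup>n v\<close>; for \<open>v\<close> in the stable direction it
  tends to \<open>0\<close> by continuity of translations in measure, and the same holds for the unstable
  direction and the inverse of \<open>f\<close>. So \<open>F\<close> is invariant modulo null sets under all translations,
  hence trivial, again by Fubini.

  Entropy (\<open>ks_entropy_\<mu>\<close>): for a partition into small sets, a cell of its \<open>n\<close>-fold join lies in a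
  Bowen ball, which \<open>f\<^sup>j\<close> with \<open>j \<approx> n/2\<close> maps into a ball of radius \<open>O(\<Lambda>\<^sup>-\<^sup>j)\<close>. So cells have
  measure \<open>O(\<Lambda>\<^sup>-\<^sup>n)\<close>, and the entropy is at least \<open>ln \<Lambda>\<close>.

  Return times (\<open>AE_return_time_limit\<close>): consider the integral map \<open>N = f\<^sup>k\<^sup>-\<^sup>j - f\<^sup>-\<^sup>j\<close> with
  \<open>j = k div 2\<close>. It differs from \<open>f\<^sup>k - 1\<close> by the unimodular factor \<open>f\<^sup>j\<close>, so the points of
  period \<open>k\<close> are the points mapped into the lattice by \<open>N\<close>, and \<open>N\<close> expands all
  directions by about \<open>\<Lambda>\<^sup>k\<^sup>/\<^sup>2\<close>. For \<open>k = 2j\<close>, every point therefore has a point of period \<open>2j\<close>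
  within \<open>O(\<Lambda>\<^sup>-\<^sup>j)\<close>, which bounds the return time of every ball of radius \<open>r\<close> by
  \<open>2 (- ln r) / ln \<Lambda> + O(1)\<close>. Conversely, if the ball of radius \<open>r\<close> around \<open>x\<close> returns at time \<open>k\<close>,
  then \<open>N x\<close> is within \<open>O(\<Lambda>\<^sup>k\<^sup>/\<^sup>2 r)\<close> of the lattice. As \<open>N\<close> preserves Haar measure, this happens
  with probability \<open>O(\<Lambda>\<^sup>k r\<^sup>2)\<close>; summing over \<open>k \<le> a n\<close> with \<open>a < 2\<close> and \<open>r = \<Lambda>\<^sup>-\<^sup>n\<close> leaves a
  convergent series, and the lower bound follows from the Borel--Cantelli lemma.
\<close>

section \<open>Haar measure as Lebesgue measure on the unit cube\<close>

text \<open>The lattice \<open>\<int>\<^sup>n\<close>, as a set of real vectors.\<close>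

definition int_lattice :: "(real^'n) set" where
  "int_lattice = {m. \<forall>i. m $ i \<in> \<int>}"

text \<open>Lifts of subsets of the torus. One inclusion suffices, as the lattice is closed under negation.\<close>

definition periodic :: "(real^'n) set \<Rightarrow> bool" where
  "periodic F \<longleftrightarrow> (\<forall>x\<in>F. \<forall>m\<in>int_lattice. x + m \<in> F)"

text \<open>The half-open cube, an exact fundamental domain of the lattice.\<close>

definition unit_cube :: "(real^'n) set" where
  "unit_cube = {x. \<forall>i. 0 \<le> x $ i \<and> x $ i < 1}"

text \<open>The measure of the torus, placed on its fundamental domain in \<open>\<real>\<^sup>n\<close>: for the lift \<open>F\<close> of a set,
  \<open>cube_measure F\<close> is the Haar measure of the set.\<close>

definition cube_measure :: "(real^'n) measure" where
  "cube_measure = uniform_measure lborel unit_cube"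

lemma zero_in_int_lattice [simp]: "0 \<in> int_lattice"
  by (simp add: int_lattice_def)

lemma int_lattice_add [intro]: "m \<in> int_lattice \<Longrightarrow> n \<in> int_lattice \<Longrightarrow> m + n \<in> int_lattice"
  by (simp add: int_lattice_def)

lemma int_lattice_diff [intro]: "m \<in> int_lattice \<Longrightarrow> n \<in> int_lattice \<Longrightarrow> m - n \<in> int_lattice"
  by (simp add: int_lattice_def)

lemma int_lattice_uminus [intro]: "m \<in> int_lattice \<Longrightarrow> - m \<in> int_lattice"
  by (simp add: int_lattice_def)

lemma countable_int_lattice: "countable (int_lattice :: (real^'n) set)"
proof -
  have "int_lattice \<subseteq> range (\<lambda>k::int^'n. \<chi> i. real_of_int (k $ i))"
  proof
    fix m :: "real^'n" assume m: "m \<in> int_lattice"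
    have "m = (\<chi> i. real_of_int ((\<chi> j. \<lfloor>m $ j\<rfloor>) $ i))"
      using m by (auto simp: int_lattice_def vec_eq_iff)
    then show "m \<in> range (\<lambda>k::int^'n. \<chi> i. real_of_int (k $ i))"
      by blast
  qed
  then show ?thesis by (rule countable_subset) auto
qed

lemma int_lattice_eq_0:
  assumes "m \<in> int_lattice" "norm m < 1"
  shows "m = 0"
proof -
  have "m $ i = 0" for i
  proof -
    have "\<bar>m $ i\<bar> < 1"
      using component_le_norm_cart[of m i] assms(2) by linarith
    moreover have "m $ i \<in> \<int>" using assms(1) by (simp add: int_lattice_def)
    ultimately show ?thesis by (auto elim!: Ints_cases)
  qed
  then show ?thesis by (simp add: vec_eq_iff)
qed

lemma periodic_iff: "periodic F \<Longrightarrow> m \<in> int_lattice \<Longrightarrow> x + m \<in> F \<longleftrightarrow> x \<in> F"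
  unfolding periodic_def by (metis add_diff_cancel int_lattice_uminus add_uminus_conv_diff)

lemma unit_cube_measurable [measurable]: "unit_cube \<in> sets borel"
  unfolding unit_cube_def by measurable

lemma emeasure_unit_cube [simp]: "emeasure lborel (unit_cube :: (real^'n) set) = 1"
proof (rule antisym)
  have "unit_cube \<subseteq> cbox 0 (1::real^'n)"
    by (auto simp: unit_cube_def mem_box_cart less_imp_le)
  then have "emeasure lborel (unit_cube :: (real^'n) set) \<le> emeasure lborel (cbox 0 (1::real^'n))"
    by (intro emeasure_mono) auto
  also have "\<dots> = 1"
    by (subst emeasure_lborel_cbox) (auto intro!: prod.neutral simp: Basis_vec_def inner_axis)
  finally show "emeasure lborel (unit_cube :: (real^'n) set) \<le> 1" .
  have "1 = emeasure lborel (box 0 (1::real^'n))"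
    by (subst emeasure_lborel_box) (auto intro!: prod.neutral simp: Basis_vec_def inner_axis)
  also have "\<dots> \<le> emeasure lborel (unit_cube :: (real^'n) set)"
    by (intro emeasure_mono) (auto simp: unit_cube_def mem_box_cart less_imp_le)
  finally show "1 \<le> emeasure lborel (unit_cube :: (real^'n) set)" .
qed

lemma sets_cube_measure [simp, measurable_cong]: "sets cube_measure = sets borel"
  by (simp add: cube_measure_def)

lemma space_cube_measure [simp]: "space cube_measure = UNIV"
  by (simp add: cube_measure_def)

lemma prob_space_cube_measure: "prob_space (cube_measure :: (real^'n) measure)"
  unfolding cube_measure_def by (rule prob_space_uniform_measure) auto

lemma emeasure_cube_measure:
  "F \<in> sets borel \<Longrightarrow> emeasure cube_measure F = emeasure lborel (F \<inter> unit_cube)"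
  unfolding cube_measure_def by (subst emeasure_uniform_measure) (auto simp: Int_commute divide_ennreal_def)

lemma ex1_translate_unit_cube:
  fixes x a :: "real^'n"
  shows "\<exists>!m. m \<in> int_lattice \<and> x - m - a \<in> unit_cube"
proof
  let ?m = "\<chi> i. real_of_int \<lfloor>x $ i - a $ i\<rfloor>"
  show "?m \<in> int_lattice \<and> x - ?m - a \<in> unit_cube"
    by (auto simp: int_lattice_def unit_cube_def) linarith+
next
  fix m assume m: "m \<in> int_lattice \<and> x - m - a \<in> unit_cube"
  show "m = (\<chi> i. real_of_int \<lfloor>x $ i - a $ i\<rfloor>)"
  proof (subst vec_eq_iff, safe)
    fix i
    obtain k where k: "m $ i = of_int k" using m by (auto simp: int_lattice_def elim: Ints_cases)
    have "0 \<le> x $ i - m $ i - a $ i" "x $ i - m $ i - a $ i < 1"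
      using m by (auto simp: unit_cube_def)
    then have "\<lfloor>x $ i - a $ i\<rfloor> = k" unfolding k by linarith
    then show "m $ i = (\<chi> i. real_of_int \<lfloor>x $ i - a $ i\<rfloor>) $ i" by (simp add: k)
  qed
qed

lemma emeasure_lborel_translate:
  fixes F :: "'a::euclidean_space set"
  assumes "F \<in> sets borel"
  shows "emeasure lborel ((\<lambda>x. x + a) -` F) = emeasure lborel F"
proof -
  have "emeasure lborel F = emeasure (distr lborel borel ((+) a)) F"
    by (simp add: lborel_distr_plus)
  also have "\<dots> = emeasure lborel ((+) a -` F)"
    using assms by (subst emeasure_distr) auto
  also have "(+) a -` F = (\<lambda>x. x + a) -` F"
    by (auto simp: add.commute)
  finally show ?thesis by simp
qed

text \<open>A periodic set has the same measure in a translated fundamental domain: cut each of the two cubes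
  along the lattice translates of the other; the pieces correspond by lattice translations.\<close>

lemma emeasure_fundamental_domain:
  fixes F :: "(real^'n) set"
  assumes F: "F \<in> sets borel" "periodic F"
  shows "emeasure lborel (F \<inter> (\<lambda>x. x - a) -` unit_cube) = emeasure lborel (F \<inter> unit_cube)"
proof -
  define Q where "Q = (\<lambda>x::real^'n. x - a) -` unit_cube"
  have [measurable]: "Q \<in> sets borel"
  proof -
    have "(\<lambda>x::real^'n. x - a) -` unit_cube \<inter> space borel \<in> sets borel"
      by (rule measurable_sets[of _ borel borel]) auto
    then show ?thesis by (simp add: Q_def)
  qed
  have [measurable]: "(\<lambda>x. x - m) -` Q \<in> sets borel" "(\<lambda>x. x + m) -` unit_cube \<in> sets borel" for m
    using measurable_sets[of "\<lambda>x. x - m" borel borel Q]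
     measurable_sets[of "\<lambda>x. x + m" borel borel "unit_cube :: (real^'n) set"] by auto
  note [measurable] = F(1)
  have "emeasure lborel (F \<inter> unit_cube)
      = emeasure lborel (\<Union>m\<in>int_lattice. F \<inter> unit_cube \<inter> (\<lambda>x. x - m) -` Q)"
  proof (rule arg_cong[where f="emeasure lborel"])
    show "F \<inter> unit_cube = (\<Union>m\<in>int_lattice. F \<inter> unit_cube \<inter> (\<lambda>x. x - m) -` Q)"
    proof -
      have "\<exists>m\<in>int_lattice. x - m \<in> Q" for x
        using ex1_translate_unit_cube[of x a] by (auto simp: Q_def)
      then show ?thesis by blast
    qed
  qed
  also have "\<dots> = (\<integral>\<^sup>+m. emeasure lborel (F \<inter> unit_cube \<inter> (\<lambda>x. x - m) -` Q) \<partial>count_space int_lattice)"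
  proof (rule emeasure_UN_countable)
    show "disjoint_family_on (\<lambda>m. F \<inter> unit_cube \<inter> (\<lambda>x. x - m) -` Q) int_lattice"
      unfolding disjoint_family_on_def
    proof (safe, goal_cases)
      case (1 m n x)
      then have "m = n"
        using ex1_translate_unit_cube[of x a] by (auto simp: Q_def)
      with 1 show ?case by simp
    qed
  qed (auto intro: countable_int_lattice)
  also have "\<dots> = (\<integral>\<^sup>+m. emeasure lborel (F \<inter> Q \<inter> (\<lambda>x. x + m) -` unit_cube) \<partial>count_space int_lattice)"
  proof (rule nn_integral_cong)
    fix m :: "real^'n" assume "m \<in> space (count_space int_lattice)"
    then have m: "m \<in> int_lattice" by simp
    have "(\<lambda>x. x + m) -` (F \<inter> unit_cube \<inter> (\<lambda>x. x - m) -` Q) = F \<inter> Q \<inter> (\<lambda>x. x + m) -` unit_cube"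
      using periodic_iff[OF F(2) m] by auto
    then show "emeasure lborel (F \<inter> unit_cube \<inter> (\<lambda>x. x - m) -` Q)
        = emeasure lborel (F \<inter> Q \<inter> (\<lambda>x. x + m) -` unit_cube)"
      using emeasure_lborel_translate[of "F \<inter> unit_cube \<inter> (\<lambda>x. x - m) -` Q" m] by simp
  qed
  also have "\<dots> = emeasure lborel (\<Union>m\<in>int_lattice. F \<inter> Q \<inter> (\<lambda>x. x + m) -` unit_cube)"
  proof (rule emeasure_UN_countable[symmetric])
    show "disjoint_family_on (\<lambda>m. F \<inter> Q \<inter> (\<lambda>x. x + m) -` unit_cube) int_lattice"
      unfolding disjoint_family_on_def
    proof (safe, goal_cases)
      case (1 m n x)
      then have "- m = - n"
        using ex1_translate_unit_cube[of x 0]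
        by (metis int_lattice_uminus diff_minus_eq_add diff_zero)
      with 1 show ?case by simp
    qed
  qed (auto intro: countable_int_lattice)
  also have "(\<Union>m\<in>int_lattice. F \<inter> Q \<inter> (\<lambda>x. x + m) -` unit_cube) = F \<inter> Q"
  proof -
    have "\<exists>m\<in>int_lattice. x + m \<in> unit_cube" for x :: "real^'n"
      using ex1_translate_unit_cube[of x 0] int_lattice_uminus
      by (metis diff_conv_add_uminus diff_zero)
    then show ?thesis by blast
  qed
  finally show ?thesis by (simp add: Q_def)
qed

lemma cube_measure_translate:
  fixes F :: "(real^'n) set"
  assumes F: "F \<in> sets borel" "periodic F"
  shows "emeasure cube_measure ((\<lambda>x. x + a) -` F) = emeasure cube_measure F"
proof -
  have m: "F \<inter> (\<lambda>x. x - a) -` unit_cube \<in> sets borel" "(\<lambda>x. x + a) -` F \<in> sets borel"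
    using measurable_sets[of "\<lambda>x. x - a" borel borel "unit_cube :: (real^'n) set"]
      measurable_sets[of "\<lambda>x. x + a" borel borel F] F by auto
  have "emeasure cube_measure ((\<lambda>x. x + a) -` F) = emeasure lborel ((\<lambda>x. x + a) -` F \<inter> unit_cube)"
    using m by (simp add: emeasure_cube_measure)
  also have "(\<lambda>x. x + a) -` F \<inter> unit_cube = (\<lambda>x. x + a) -` (F \<inter> (\<lambda>x. x - a) -` unit_cube)"
    by auto
  also have "emeasure lborel \<dots> = emeasure lborel (F \<inter> unit_cube)"
    using emeasure_lborel_translate[OF m(1)] emeasure_fundamental_domain[OF F] by simp
  finally show ?thesis using F by (simp add: emeasure_cube_measure)
qed

text \<open>Surjective endomorphisms preserve Haar measure: integrate the indicator of \<open>f x + y \<in> F\<close> over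
  \<open>x\<close> and \<open>y\<close> in both orders, using that translation by \<open>y = f z\<close> becomes translation of \<open>x\<close> by \<open>z\<close>.\<close>

lemma cube_measure_endomorphism:
  fixes F :: "(real^'n) set" and f :: "real^'n \<Rightarrow> real^'n"
  assumes f: "linear f" "surj f" "f ` int_lattice \<subseteq> int_lattice"
    and F: "F \<in> sets borel" "periodic F"
  shows "emeasure cube_measure (f -` F) = emeasure cube_measure F"
proof -
  interpret U: prob_space "cube_measure :: (real^'n) measure" by (rule prob_space_cube_measure)
  interpret pair_sigma_finite "cube_measure :: (real^'n) measure" "cube_measure :: (real^'n) measure"
    by unfold_locales
  have cf: "continuous_on UNIV f" using f(1) by (simp add: linear_continuous_on linear_linear)
  have fm [measurable]: "f \<in> borel_measurable borel" using cf by (rule borel_measurable_continuous_onI)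
  note [measurable] = F(1)
  have fF: "f -` F \<in> sets borel" "periodic (f -` F)"
    using measurable_sets[OF fm F(1)] F(2) f by (auto simp: periodic_def linear_add)
  have I: "(\<integral>\<^sup>+x. indicator F (x + y) \<partial>cube_measure) = emeasure cube_measure F"
     if "F \<in> sets borel" "periodic F" for F and y :: "real^'n"
  proof -
    have "(\<integral>\<^sup>+x. indicator F (x + y) \<partial>cube_measure) = (\<integral>\<^sup>+x. indicator ((\<lambda>x. x + y) -` F) x \<partial>cube_measure)"
      by (simp add: indicator_def)
    also have "\<dots> = emeasure cube_measure ((\<lambda>x. x + y) -` F)"
      using measurable_sets[of "\<lambda>x. x + y" borel borel F] that by (intro nn_integral_indicator) auto
    finally show ?thesis using cube_measure_translate[OF that] by simp
  qed
  have "emeasure cube_measure (f -` F)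
      = (\<integral>\<^sup>+y. (\<integral>\<^sup>+x. indicator F (f x + y) \<partial>cube_measure) \<partial>(cube_measure :: (real^'n) measure))"
  proof -
    have "(\<integral>\<^sup>+x. indicator F (f x + y) \<partial>cube_measure) = emeasure cube_measure (f -` F)" for y
    proof -
      obtain z where z: "f z = y" using f(2) by (metis surjD)
      have "(\<integral>\<^sup>+x. indicator F (f x + y) \<partial>cube_measure) = (\<integral>\<^sup>+x. indicator (f -` F) (x + z) \<partial>cube_measure)"
        using f(1) by (simp add: indicator_def linear_add z)
      then show ?thesis using I[OF fF] by simp
    qed
    then show ?thesis by (simp add: U.emeasure_space_1[simplified])
  qed
  also have "\<dots> = (\<integral>\<^sup>+x. (\<integral>\<^sup>+y. indicator F (f x + y) \<partial>cube_measure) \<partial>(cube_measure :: (real^'n) measure))"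
    by (rule Fubini') measurable
  also have "\<dots> = emeasure cube_measure F"
  proof -
    have "(\<integral>\<^sup>+y. indicator F (f x + y) \<partial>cube_measure) = emeasure cube_measure F" for x
      using I[OF F, of "f x"] by (simp add: add.commute)
    then show ?thesis by (simp add: U.emeasure_space_1[simplified])
  qed
  finally show ?thesis .
qed

text \<open>The lift of the ball of radius \<open>\<rho>\<close> around the class of \<open>c\<close>.\<close>

definition near_lattice :: "real^'n \<Rightarrow> real \<Rightarrow> (real^'n) set" where
  "near_lattice c \<rho> = {z. \<exists>m\<in>int_lattice. dist z (c + m) < \<rho>}"

lemma open_near_lattice: "open (near_lattice c \<rho>)"
proof -
  have "near_lattice c \<rho> = (\<Union>m\<in>int_lattice. ball (c + m) \<rho>)"
    unfolding near_lattice_def ball_def dist_commute[of "c + _"] by blast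
  then show ?thesis by (simp add: open_UN)
qed

lemma periodic_near_lattice: "periodic (near_lattice (c :: real^'n) \<rho>)"
  unfolding periodic_def
proof safe
  fix x m :: "real^'n" assume "x \<in> near_lattice c \<rho>" and m: "m \<in> int_lattice"
  then obtain k where k: "k \<in> int_lattice" "dist x (c + k) < \<rho>"
    by (auto simp: near_lattice_def)
  have "dist (x + m) (c + (k + m)) < \<rho>"
    using k(2) by (simp add: dist_norm algebra_simps)
  then show "x + m \<in> near_lattice c \<rho>"
    using k m by (auto simp: near_lattice_def)
qed

lemma emeasure_near_lattice_le:
  fixes c :: "real^2"
  assumes "\<rho> \<ge> 0"
  shows "emeasure cube_measure (near_lattice c \<rho>) \<le> ennreal (4 * \<rho>\<^sup>2)"
proof (cases "\<rho> \<le> 1/2")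
  case False
  interpret U: prob_space "cube_measure :: (real^2) measure" by (rule prob_space_cube_measure)
  have "(1/2)\<^sup>2 \<le> \<rho>\<^sup>2" using False by (intro power_mono) auto
  then have "1 \<le> ennreal (4 * \<rho>\<^sup>2)" by (simp add: power2_eq_square)
  then show ?thesis using U.emeasure_le_1 order_trans by blast
next
  case True
  \<comment> \<open>Centred in the cube, a ball of radius at most \<open>1/2\<close> meets no other lattice translate of itself.\<close>
  define h :: "real^2" where "h = (\<chi> i. 1/2)"
  define w :: "real^2" where "w = (\<chi> i. \<rho>)"
  have "near_lattice c \<rho> = (\<lambda>x. x + (h - c)) -` near_lattice h \<rho>"
  proof -
    have "dist (x + (h - c)) (h + m) = dist x (c + m)" for x m
      by (simp add: dist_norm algebra_simps)
    then show ?thesis by (simp add: near_lattice_def)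
  qed
  then have "emeasure cube_measure (near_lattice c \<rho>) = emeasure cube_measure (near_lattice h \<rho>)"
    using open_near_lattice[of h \<rho>] by (simp add: cube_measure_translate periodic_near_lattice)
  also have "\<dots> = emeasure lborel (near_lattice h \<rho> \<inter> unit_cube)"
    by (simp add: emeasure_cube_measure open_near_lattice)
  also have "\<dots> \<le> emeasure lborel (cbox (h - w) (h + w))"
  proof (rule emeasure_mono)
    show "near_lattice h \<rho> \<inter> unit_cube \<subseteq> cbox (h - w) (h + w)"
    proof
      fix z assume z: "z \<in> near_lattice h \<rho> \<inter> unit_cube"
      then obtain m where m: "m \<in> int_lattice" "norm (z - (h + m)) < \<rho>"
        by (auto simp: near_lattice_def dist_norm)
      have "\<bar>z $ i - 1/2\<bar> < \<rho>" for i
      proof -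
        obtain k where k: "m $ i = of_int k" using m by (auto simp: int_lattice_def elim: Ints_cases)
        have "\<bar>z $ i - (1/2 + k)\<bar> < \<rho>"
          using component_le_norm_cart[of "z - (h + m)" i] m(2) by (simp add: h_def k)
        moreover have "0 \<le> z $ i" "z $ i < 1" using z by (auto simp: unit_cube_def)
        ultimately have "- 1 < real_of_int k" "real_of_int k < 1" using True by linarith+
        then have "k = 0" by linarith
        with \<open>\<bar>z $ i - (1/2 + k)\<bar> < \<rho>\<close> show ?thesis by simp
      qed
      then have "\<bar>z $ i - h $ i\<bar> < w $ i" for i by (simp add: h_def w_def)
      then show "z \<in> cbox (h - w) (h + w)"
        unfolding mem_box_cart by (simp add: abs_less_iff) (smt (verit))
    qed
  qed auto
  also have "\<dots> = ennreal (4 * \<rho>\<^sup>2)"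
  proof -
    have "(h + w - (h - w)) \<bullet> b = 2 * \<rho>" if "b \<in> Basis" for b
      using that by (auto simp: w_def Basis_vec_def inner_axis)
    moreover have "(h - w) \<bullet> b \<le> (h + w) \<bullet> b" if "b \<in> Basis" for b
      using that assms by (auto simp: w_def Basis_vec_def inner_axis)
    ultimately show ?thesis
      by (subst emeasure_lborel_cbox) (auto simp: power2_eq_square)
  qed
  finally show ?thesis .
qed

lemma measure_near_lattice_le:
  fixes c :: "real^2"
  assumes "\<rho> \<ge> 0"
  shows "measure cube_measure (near_lattice c \<rho>) \<le> 4 * \<rho>\<^sup>2"
  using emeasure_near_lattice_le[OF assms, of c] unfolding measure_def
  by (metis enn2real_leI mult_nonneg_nonneg zero_le_numeral zero_le_power2)

text \<open>With \<open>K \<subseteq> F\<close> compact and \<open>V \<supseteq> K\<close> open, both close to the part of \<open>F\<close> in the cube, a point of \<open>K\<close>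
  that a short translation moves out of \<open>F\<close> lands in \<open>V - K\<close>.\<close>

lemma translation_continuous_in_measure:
  fixes F :: "(real^'n) set"
  assumes F: "F \<in> sets borel" and "\<epsilon> > 0"
  shows "\<exists>\<delta>>0. \<forall>w. norm w < \<delta> \<longrightarrow> emeasure cube_measure (F - (\<lambda>x. x + w) -` F) \<le> ennreal \<epsilon>"
proof -
  define S where "S = F \<inter> unit_cube"
  have S: "S \<in> sets borel" using F by (simp add: S_def)
  have "S \<subseteq> cbox 0 1" by (auto simp: S_def unit_cube_def mem_box_cart less_imp_le)
  then have "bounded S" using bounded_cbox bounded_subset by blast
  have S': "S \<in> sets lebesgue" using S by simp
  obtain K where K: "closed K" "K \<subseteq> S" "S - K \<in> lmeasurable" "emeasure lebesgue (S - K) < ennreal (\<epsilon> / 2)"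
    by (rule sets_lebesgue_inner_closed[OF S' half_gt_zero[OF \<open>\<epsilon> > 0\<close>]])
  have "compact K"
    using K \<open>bounded S\<close> bounded_subset compact_eq_bounded_closed by blast
  have K': "K \<in> sets lebesgue" using K(1) by simp
  obtain V where V: "open V" "K \<subseteq> V" "V - K \<in> lmeasurable" "emeasure lebesgue (V - K) < ennreal (\<epsilon> / 2)"
    by (rule sets_lebesgue_outer_open[OF K' half_gt_zero[OF \<open>\<epsilon> > 0\<close>]])
  obtain \<delta> where \<delta>: "\<delta> > 0" "(\<Union>x\<in>K. ball x \<delta>) \<subseteq> V"
    using compact_subset_open_imp_ball_epsilon_subset[OF \<open>compact K\<close> V(1,2)] by blast
  have "emeasure cube_measure (F - (\<lambda>x. x + w) -` F) \<le> ennreal \<epsilon>" if w: "norm w < \<delta>" for w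
  proof -
    have [measurable]: "(\<lambda>x. x + w) -` F \<in> sets borel" "(\<lambda>x. x + w) -` (V - K) \<in> sets borel"
      using measurable_sets[of "\<lambda>x. x + w" borel borel F] F
        measurable_sets[of "\<lambda>x. x + w" borel borel "V - K"] V K by auto
    note [measurable] = F S borel_closed[OF K(1)]
    have "emeasure cube_measure (F - (\<lambda>x. x + w) -` F)
        = emeasure lborel ((F - (\<lambda>x. x + w) -` F) \<inter> unit_cube)"
      by (rule emeasure_cube_measure) measurable
    also have "\<dots> \<le> emeasure lborel ((S - K) \<union> (\<lambda>x. x + w) -` (V - K))"
    proof (rule emeasure_mono)
      show "(F - (\<lambda>x. x + w) -` F) \<inter> unit_cube \<subseteq> (S - K) \<union> (\<lambda>x. x + w) -` (V - K)"
      proof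
        fix x assume x: "x \<in> (F - (\<lambda>x. x + w) -` F) \<inter> unit_cube"
        show "x \<in> (S - K) \<union> (\<lambda>x. x + w) -` (V - K)"
        proof (cases "x \<in> K")
          case True
          then have "x + w \<in> V"
            using \<delta>(2) w by (intro subsetD[OF \<delta>(2)] UN_I[of x]) (auto simp: dist_norm)
          moreover have "x + w \<notin> K" using x K(2) by (auto simp: S_def)
          ultimately show ?thesis by simp
        qed (use x in \<open>auto simp: S_def\<close>)
      qed
    qed measurable
    also have "\<dots> \<le> emeasure lborel (S - K) + emeasure lborel ((\<lambda>x. x + w) -` (V - K))"
      by (rule emeasure_subadditive) measurable
    also have "emeasure lborel ((\<lambda>x. x + w) -` (V - K)) = emeasure lborel (V - K)"
      using V K by (intro emeasure_lborel_translate) auto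
    also have "emeasure lborel (S - K) + emeasure lborel (V - K) \<le> ennreal (\<epsilon>/2) + ennreal (\<epsilon>/2)"
      using K V S by (intro add_mono) auto
    also have "\<dots> = ennreal \<epsilon>"
      using \<open>\<epsilon> > 0\<close> by (simp flip: ennreal_plus)
    finally show ?thesis .
  qed
  then show ?thesis using \<delta>(1) by blast
qed

text \<open>Integrating the indicator of \<open>x \<in> F \<and> x + y \<notin> F\<close> in both orders gives
  \<open>0 = \<mu> F * \<mu> (- F)\<close>.\<close>

lemma translation_invariant_trivial:
  fixes F :: "(real^'n) set"
  assumes F: "F \<in> sets borel" "periodic F"
    and inv: "\<And>v. emeasure cube_measure (F - (\<lambda>x. x + v) -` F) = 0"
  shows "measure cube_measure F = 0 \<or> measure cube_measure F = 1"
proof -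
  interpret U: prob_space "cube_measure :: (real^'n) measure" by (rule prob_space_cube_measure)
  interpret pair_sigma_finite "cube_measure :: (real^'n) measure" "cube_measure :: (real^'n) measure"
    by unfold_locales
  note [measurable] = F(1)
  have F': "- F \<in> sets borel" "periodic (- F)"
    using F unfolding periodic_def by (auto simp: periodic_iff[OF F(2)] Compl_eq_Diff_UNIV)
  have meas: "(\<lambda>x. x + y) -` (- F) \<in> sets borel" for y
    using measurable_sets[of "\<lambda>x. x + y" borel borel "- F"] F' by auto
  have "0 = (\<integral>\<^sup>+y. emeasure cube_measure (F - (\<lambda>x. x + y) -` F) \<partial>(cube_measure :: (real^'n) measure))"
    by (simp add: inv)
  also have "\<dots> = (\<integral>\<^sup>+y. (\<integral>\<^sup>+x. indicator F x * indicator (- F) (x + y) \<partial>cube_measure) \<partial>(cube_measure :: (real^'n) measure))"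
  proof (rule nn_integral_cong)
    fix y :: "real^'n"
    have "(\<integral>\<^sup>+x. indicator F x * indicator (- F) (x + y) \<partial>cube_measure)
        = (\<integral>\<^sup>+x. indicator (F - (\<lambda>x. x + y) -` F) x \<partial>cube_measure)"
      by (rule nn_integral_cong) (auto simp: indicator_def)
    also have "\<dots> = emeasure cube_measure (F - (\<lambda>x. x + y) -` F)"
      using meas[of y] F(1) by (intro nn_integral_indicator) (auto simp: vimage_Compl Diff_eq)
    finally show "emeasure cube_measure (F - (\<lambda>x. x + y) -` F)
        = (\<integral>\<^sup>+x. indicator F x * indicator (- F) (x + y) \<partial>cube_measure)" by simp
  qed
  also have "\<dots> = (\<integral>\<^sup>+x. (\<integral>\<^sup>+y. indicator F x * indicator (- F) (x + y) \<partial>cube_measure) \<partial>(cube_measure :: (real^'n) measure))"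
    by (rule Fubini') measurable
  also have "\<dots> = (\<integral>\<^sup>+x. indicator F x * emeasure cube_measure (- F) \<partial>(cube_measure :: (real^'n) measure))"
  proof (rule nn_integral_cong)
    fix x :: "real^'n"
    have "(\<integral>\<^sup>+y. indicator (- F) (x + y) \<partial>cube_measure)
        = (\<integral>\<^sup>+y. indicator ((\<lambda>y. y + x) -` (- F)) y \<partial>cube_measure)"
      by (simp add: indicator_def add.commute)
    also have "\<dots> = emeasure cube_measure (- F)"
      using meas cube_measure_translate[OF F'] by (subst nn_integral_indicator) auto
    finally show "(\<integral>\<^sup>+y. indicator F x * indicator (- F) (x + y) \<partial>cube_measure)
        = indicator F x * emeasure cube_measure (- F)"
      by (subst nn_integral_cmult) auto
  qed
  also have "\<dots> = emeasure cube_measure F * emeasure cube_measure (- F)"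
    by (subst nn_integral_multc) auto
  finally have "emeasure cube_measure F = 0 \<or> emeasure cube_measure (- F) = 0"
    by (metis mult_eq_0_iff)
  then show ?thesis
  proof
    assume "emeasure cube_measure (- F) = 0"
    then have "measure cube_measure (space cube_measure - F) = 0"
      by (simp add: measure_def Compl_eq_Diff_UNIV)
    then show ?thesis using U.prob_compl[of F] F by simp
  qed (simp add: measure_def)
qed

lemma translate_measurable:
  fixes F :: "(real^'n) set"
  assumes "F \<in> sets borel"
  shows "(\<lambda>x. x + w) -` F \<in> sets borel"
  using measurable_sets[of "\<lambda>x. x + w" borel borel F] assms by auto

lemma periodic_diff_translate:
  fixes F :: "(real^'n) set"
  assumes "periodic F"
  shows "periodic (F - (\<lambda>x. x + w) -` F)"
  unfolding periodic_def
proof (intro ballI)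
  fix x m :: "real^'n" assume x: "x \<in> F - (\<lambda>x. x + w) -` F" and m: "m \<in> int_lattice"
  have "x + m + w = (x + w) + m" by simp
  then have "x + m + w \<in> F \<longleftrightarrow> x + w \<in> F"
    using periodic_iff[OF assms m] by metis
  then show "x + m \<in> F - (\<lambda>x. x + w) -` F"
    using x periodic_iff[OF assms m] by simp
qed

section \<open>Hyperbolic maps of the plane and ergodicity\<close>

text \<open>A hyperbolic toral automorphism, lifted to a linear map \<open>f\<close> of the plane with inverse \<open>g\<close>. The
  splitting is encoded by two linear functionals, the left eigenvectors: \<open>u\<close> is the
  coordinate along the unstable direction (which is the kernel of \<open>s\<close>), and \<open>s\<close> the one along
  the stable direction (the kernel of \<open>u\<close>). The constant \<open>K\<close> compares
  \<open>\<bar>u x\<bar> + \<bar>s x\<bar>\<close> with the Euclidean norm.\<close>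

locale hyperbolic_lattice_map =
  fixes f g :: "real^2 \<Rightarrow> real^2" and u s :: "real^2 \<Rightarrow> real" and \<alpha> \<beta> K :: real
  assumes linear_f: "linear f" and linear_g: "linear g"
    and f_lattice: "f ` int_lattice \<subseteq> int_lattice" and g_lattice: "g ` int_lattice \<subseteq> int_lattice"
    and f_g [simp]: "f (g x) = x" and g_f [simp]: "g (f x) = x"
    and linear_u: "linear u" and linear_s: "linear s"
    and u_f [simp]: "u (f x) = \<alpha> * u x" and s_f [simp]: "s (f x) = \<beta> * s x"
    and \<alpha>_gt_1: "1 < \<bar>\<alpha>\<bar>" and \<alpha>_\<beta>: "\<bar>\<alpha> * \<beta>\<bar> = 1" and K_pos: "0 < K"
    and u_le: "\<bar>u x\<bar> \<le> K * norm x" and s_le: "\<bar>s x\<bar> \<le> K * norm x"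
    and norm_le: "norm x \<le> K * (\<bar>u x\<bar> + \<bar>s x\<bar>)"
    and splitting: "\<exists>a b. x = a + b \<and> s a = 0 \<and> u b = 0"
begin

abbreviation \<Lambda> :: real where "\<Lambda> \<equiv> \<bar>\<alpha>\<bar>"

lemma \<Lambda>_pos [simp]: "0 < \<Lambda>" "0 \<noteq> \<alpha>" "\<alpha> \<noteq> 0"
  using \<alpha>_gt_1 by auto

lemma abs_\<beta>: "\<bar>\<beta>\<bar> = inverse \<Lambda>"
  using \<alpha>_\<beta> by (simp add: abs_mult field_simps)

lemma \<beta>_nz [simp]: "\<beta> \<noteq> 0"
  using \<alpha>_\<beta> by auto

lemma u_g [simp]: "u (g x) = u x / \<alpha>" and s_g [simp]: "s (g x) = s x / \<beta>"
  using u_f[of "g x"] s_f[of "g x"] by (simp_all add: field_simps)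

lemma u_f_pow [simp]: "u ((f ^^ n) x) = \<alpha> ^ n * u x" and s_f_pow [simp]: "s ((f ^^ n) x) = \<beta> ^ n * s x"
  by (induction n) simp_all

lemma u_g_pow [simp]: "u ((g ^^ n) x) = u x / \<alpha> ^ n" and s_g_pow [simp]: "s ((g ^^ n) x) = s x / \<beta> ^ n"
  by (induction n) simp_all

lemma linear_f_pow: "linear (f ^^ n)" and linear_g_pow: "linear (g ^^ n)"
  using linear_f linear_g by (induction n) (auto intro: linear_compose simp: linear_id[unfolded id_def] id_def)

lemma f_pow_lattice: "m \<in> int_lattice \<Longrightarrow> (f ^^ n) m \<in> int_lattice"
  and g_pow_lattice: "m \<in> int_lattice \<Longrightarrow> (g ^^ n) m \<in> int_lattice"
  using f_lattice g_lattice by (induction n) auto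

lemma g_pow_f_pow [simp]: "(g ^^ n) ((f ^^ n) x) = x"
proof (induction n arbitrary: x)
  case (Suc n)
  have "(g ^^ Suc n) ((f ^^ Suc n) x) = (g ^^ n) (g (f ((f ^^ n) x)))"
    by (subst funpow_Suc_right) simp
  then show ?case using Suc by simp
qed simp

lemma f_pow_g_pow [simp]: "(f ^^ n) ((g ^^ n) x) = x"
proof (induction n arbitrary: x)
  case (Suc n)
  have "(f ^^ Suc n) ((g ^^ Suc n) x) = (f ^^ n) (f (g ((g ^^ n) x)))"
    by (subst funpow_Suc_right) simp
  then show ?case using Suc by simp
qed simp

lemma surj_f: "surj f" and surj_g: "surj g"
  by (auto intro!: surjI[of f g] surjI[of g f])

lemma f_pow_stable_tendsto_0:
  assumes "u v = 0"
  shows "(\<lambda>n. norm ((f ^^ n) v)) \<longlonglongrightarrow> 0"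
proof (rule tendsto_sandwich[OF _ _ tendsto_const])
  show "\<forall>\<^sub>F n in sequentially. norm ((f ^^ n) v) \<le> K * (\<bar>\<beta>\<bar> ^ n * \<bar>s v\<bar>)"
    using norm_le[of "(f ^^ _) v"] assms by (auto simp: abs_mult power_abs)
  have "\<bar>\<beta>\<bar> < 1" using \<alpha>_gt_1 by (simp add: abs_\<beta> field_simps)
  then have "(\<lambda>n. \<bar>\<beta>\<bar> ^ n) \<longlonglongrightarrow> 0" by (intro LIMSEQ_power_zero) auto
  from tendsto_mult_left[OF tendsto_mult_right[OF this]]
  show "(\<lambda>n. K * (\<bar>\<beta>\<bar> ^ n * \<bar>s v\<bar>)) \<longlonglongrightarrow> 0" by (metis mult_zero_left mult_zero_right)
qed auto

lemma g_pow_unstable_tendsto_0: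
  assumes "s v = 0"
  shows "(\<lambda>n. norm ((g ^^ n) v)) \<longlonglongrightarrow> 0"
proof (rule tendsto_sandwich[OF _ _ tendsto_const])
  show "\<forall>\<^sub>F n in sequentially. norm ((g ^^ n) v) \<le> K * (inverse \<Lambda> ^ n * \<bar>u v\<bar>)"
    using norm_le[of "(g ^^ _) v"] assms by (auto simp: abs_mult power_abs divide_simps)
  have "inverse \<Lambda> < 1" using \<alpha>_gt_1 by (simp add: field_simps)
  then have "(\<lambda>n. inverse \<Lambda> ^ n) \<longlonglongrightarrow> 0" by (intro LIMSEQ_power_zero) auto
  from tendsto_mult_left[OF tendsto_mult_right[OF this]]
  show "(\<lambda>n. K * (inverse \<Lambda> ^ n * \<bar>u v\<bar>)) \<longlonglongrightarrow> 0" by (metis mult_zero_left mult_zero_right)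
qed auto

text \<open>The sets \<open>F - (F - w)\<close> for \<open>w = v, h v, h (h v), \<dots>\<close> are preimages of one another under \<open>h\<close>.\<close>

lemma invariant_set_contracted_translation:
  fixes h :: "real^2 \<Rightarrow> real^2"
  assumes h: "linear h" "surj h" "h ` int_lattice \<subseteq> int_lattice"
    and F: "F \<in> sets borel" "periodic F" "h -` F = F"
    and v: "(\<lambda>n. norm ((h ^^ n) v)) \<longlonglongrightarrow> 0"
  shows "emeasure cube_measure (F - (\<lambda>x. x + v) -` F) = 0"
proof -
  define D where "D = (\<lambda>w. F - (\<lambda>x. x + w) -` F)"
  have D: "D w \<in> sets borel" "periodic (D w)" for w
    using translate_measurable[OF F(1)] F(1) periodic_diff_translate[OF F(2)] by (auto simp: D_def)
  have eq: "emeasure cube_measure (D ((h ^^ n) v)) = emeasure cube_measure (D v)" for n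
  proof (induction n)
    case (Suc n)
    have "h -` D (h w) = D w" for w
    proof -
      have "h x \<in> F \<longleftrightarrow> x \<in> F" for x using F(3) by blast
      then show ?thesis by (auto simp: D_def simp flip: linear_add[OF h(1)])
    qed
    from this[of "(h ^^ n) v"] have "emeasure cube_measure (D ((h ^^ Suc n) v)) = emeasure cube_measure (D ((h ^^ n) v))"
      using cube_measure_endomorphism[OF h D, of "(h ^^ Suc n) v"] by simp
    then show ?case using Suc by simp
  qed simp
  have small: "emeasure cube_measure (D v) \<le> ennreal \<epsilon>" if \<epsilon>: "\<epsilon> > 0" for \<epsilon>
  proof -
    obtain \<delta> where \<delta>: "\<delta> > 0" "\<And>w. norm w < \<delta> \<Longrightarrow> emeasure cube_measure (D w) \<le> ennreal \<epsilon>"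
      using translation_continuous_in_measure[OF F(1) \<epsilon>] by (auto simp: D_def)
    obtain n where "norm ((h ^^ n) v) < \<delta>"
      using order_tendstoD(2)[OF v \<delta>(1)] by (auto simp: eventually_sequentially)
    from \<delta>(2)[OF this] show ?thesis by (simp only: eq)
  qed
  have "emeasure cube_measure (D v) \<le> 0"
  proof (rule ennreal_le_epsilon)
    fix e :: real assume "0 < e"
    from small[OF this] show "emeasure cube_measure (D v) \<le> 0 + ennreal e" by simp
  qed
  then show ?thesis by (simp add: D_def)
qed

lemma ergodic_cube_measure:
  assumes F: "F \<in> sets borel" "periodic F" "f -` F = F"
  shows "measure cube_measure F = 0 \<or> measure cube_measure F = 1"
proof (rule translation_invariant_trivial[OF F(1,2)])
  fix v
  obtain a b where ab: "v = a + b" "s a = 0" "u b = 0" using splitting by blast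
  have gF: "g -` F = F" using F(3) f_g by auto (metis vimageI vimageD f_g)+
  have *: "emeasure cube_measure (F - (\<lambda>x. x + a) -` F) = 0"
    using ab by (intro invariant_set_contracted_translation[of g] F gF linear_g surj_g g_lattice g_pow_unstable_tendsto_0)
  have **: "emeasure cube_measure (F - (\<lambda>x. x + b) -` F) = 0"
    using ab by (intro invariant_set_contracted_translation[of f] F linear_f surj_f f_lattice f_pow_stable_tendsto_0)
  have ***: "emeasure cube_measure ((\<lambda>x. x + b) -` (F - (\<lambda>x. x + a) -` F)) = 0"
  proof -
    have "F - (\<lambda>x. x + a) -` F \<in> sets borel" "periodic (F - (\<lambda>x. x + a) -` F)"
      using translate_measurable[OF F(1)] F(1) periodic_diff_translate[OF F(2)] by auto
    then show ?thesis using * by (simp add: cube_measure_translate)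
  qed
  have "emeasure cube_measure (F - (\<lambda>x. x + v) -` F)
      \<le> emeasure cube_measure ((F - (\<lambda>x. x + b) -` F) \<union> (\<lambda>x. x + b) -` (F - (\<lambda>x. x + a) -` F))"
  proof (rule emeasure_mono)
    show "F - (\<lambda>x. x + v) -` F \<subseteq> (F - (\<lambda>x. x + b) -` F) \<union> (\<lambda>x. x + b) -` (F - (\<lambda>x. x + a) -` F)"
    proof
      fix x assume "x \<in> F - (\<lambda>x. x + v) -` F"
      moreover have "x + v = x + b + a" by (simp add: ab)
      ultimately show "x \<in> (F - (\<lambda>x. x + b) -` F) \<union> (\<lambda>x. x + b) -` (F - (\<lambda>x. x + a) -` F)"
        by auto
    qed
  qed (simp, intro sets.Un sets.Diff translate_measurable F(1))
  also have "\<dots> \<le> emeasure cube_measure (F - (\<lambda>x. x + b) -` F)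
      + emeasure cube_measure ((\<lambda>x. x + b) -` (F - (\<lambda>x. x + a) -` F))"
    by (intro emeasure_subadditive; simp; intro sets.Diff translate_measurable F(1))
  also have "\<dots> = 0" by (simp only: ** *** add_0_left)
  finally show "emeasure cube_measure (F - (\<lambda>x. x + v) -` F) = 0" by simp
qed

section \<open>Expansion estimates and the sets of points with a close return\<close>

lemma abs_pow_\<beta>: "\<bar>\<beta> ^ n\<bar> = inverse (\<Lambda> ^ n)"
  by (simp add: power_abs abs_\<beta> power_inverse)

lemma \<Lambda>_pow_ge_1: "1 \<le> \<Lambda> ^ n"
  using \<alpha>_gt_1 by (simp add: one_le_power)

lemma inverse_\<Lambda>_pow_le_1: "inverse (\<Lambda> ^ n) \<le> 1"
  using \<Lambda>_pow_ge_1[of n] by (simp add: field_simps)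

lemma norm_f_pow_le: "norm ((f ^^ n) v) \<le> 2 * K\<^sup>2 * \<Lambda> ^ n * norm v"
proof -
  have 1: "\<bar>u ((f ^^ n) v)\<bar> \<le> \<Lambda> ^ n * (K * norm v)"
    using u_le[of v] by (simp add: abs_mult power_abs mult_left_mono)
  have "inverse (\<Lambda> ^ n) \<le> \<Lambda> ^ n"
    using inverse_\<Lambda>_pow_le_1[of n] \<Lambda>_pow_ge_1[of n] by linarith
  then have 2: "\<bar>s ((f ^^ n) v)\<bar> \<le> \<Lambda> ^ n * (K * norm v)"
    using s_le[of v] by (simp add: abs_mult abs_pow_\<beta> mult_mono)
  have "norm ((f ^^ n) v) \<le> K * (\<Lambda> ^ n * (K * norm v) + \<Lambda> ^ n * (K * norm v))"
    using norm_le[of "(f ^^ n) v"] 1 2 K_pos by (meson add_mono mult_left_mono less_imp_le order_trans)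
  then show ?thesis by (simp add: power2_eq_square algebra_simps)
qed

lemma norm_g_pow_le: "norm ((g ^^ n) v) \<le> 2 * K\<^sup>2 * \<Lambda> ^ n * norm v"
proof -
  have "inverse (\<Lambda> ^ n) \<le> \<Lambda> ^ n"
    using inverse_\<Lambda>_pow_le_1[of n] \<Lambda>_pow_ge_1[of n] by linarith
  then have 1: "\<bar>u ((g ^^ n) v)\<bar> \<le> \<Lambda> ^ n * (K * norm v)"
    using u_le[of v] by (simp add: abs_mult power_abs divide_inverse) (metis abs_ge_zero less_eq_real_def mult.commute mult_mono zero_le_power)
  have 2: "\<bar>s ((g ^^ n) v)\<bar> \<le> \<Lambda> ^ n * (K * norm v)"
    using s_le[of v] by (simp add: abs_mult abs_pow_\<beta> divide_inverse mult_left_mono mult.commute)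
  have "norm ((g ^^ n) v) \<le> K * (\<Lambda> ^ n * (K * norm v) + \<Lambda> ^ n * (K * norm v))"
    using norm_le[of "(g ^^ n) v"] 1 2 K_pos by (meson add_mono mult_left_mono less_imp_le order_trans)
  then show ?thesis by (simp add: power2_eq_square algebra_simps)
qed

text \<open>The map \<open>f\<^sup>k - 1\<close> composed with \<open>f\<^sup>-\<^sup>j\<close> for \<open>j = k div 2\<close>. It maps into the lattice exactly the points of
  period \<open>k\<close>, and it scales the stable and the unstable direction by comparable factors.\<close>

definition half_return :: "nat \<Rightarrow> real^2 \<Rightarrow> real^2" where
  "half_return k x = (f ^^ (k - k div 2)) x - (g ^^ (k div 2)) x"

lemma linear_half_return: "linear (half_return k)"
  unfolding half_return_def by (intro linear_compose_sub linear_f_pow linear_g_pow)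

lemma half_return_lattice: "half_return k ` int_lattice \<subseteq> int_lattice"
  by (auto simp: half_return_def intro!: int_lattice_diff f_pow_lattice g_pow_lattice)

lemma u_half_return: "u (half_return k x) = (\<alpha> ^ (k - k div 2) - inverse (\<alpha> ^ (k div 2))) * u x"
  and s_half_return: "s (half_return k x) = (\<beta> ^ (k - k div 2) - inverse (\<beta> ^ (k div 2))) * s x"
  by (simp_all add: half_return_def linear_diff[OF linear_u] linear_diff[OF linear_s] field_simps)

lemma g_pow_f_pow_diff: "j \<le> k \<Longrightarrow> (g ^^ j) ((f ^^ k) x) = (f ^^ (k - j)) x"
  using g_pow_f_pow[of j "(f ^^ (k - j)) x"] by (metis comp_apply funpow_add le_add_diff_inverse)

lemma half_return_eq: "half_return k x = (g ^^ (k div 2)) ((f ^^ k) x - x)"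
  by (simp add: half_return_def linear_diff[OF linear_g_pow] g_pow_f_pow_diff)

lemma inj_half_return:
  assumes "k > 0"
  shows "inj (half_return k)"
proof -
  have "x = 0" if "half_return k x = 0" for x
  proof -
    have "(f ^^ k) x - x = 0"
      using that f_pow_g_pow[of "k div 2" "(f ^^ k) x - x"]
      by (simp add: half_return_eq linear_0[OF linear_f_pow])
    then have fx: "(f ^^ k) x = x" by simp
    have "\<alpha> ^ k * u x = u x" "\<beta> ^ k * s x = s x"
      using u_f_pow[of k x] s_f_pow[of k x] unfolding fx by auto
    moreover have "\<bar>\<alpha> ^ k\<bar> > 1" using \<alpha>_gt_1 assms by (simp add: power_abs one_less_power)
    moreover from this have "\<bar>\<beta> ^ k\<bar> < 1" unfolding abs_pow_\<beta> by (simp add: power_abs inverse_less_1_iff)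
    ultimately have "u x = 0" "s x = 0" by auto
    then show ?thesis using norm_le[of x] by simp
  qed
  then show ?thesis using linear_injective_0[OF linear_half_return] by blast
qed

lemma surj_half_return: "k > 0 \<Longrightarrow> surj (half_return k)"
  using eucl.linear_inj_imp_surj[OF linear_half_return inj_half_return] .

text \<open>Along both directions \<open>half_return (2 * j)\<close> expands by \<open>\<Lambda>\<^sup>j - \<Lambda>\<^sup>-\<^sup>j\<close> at least, hence by
  \<open>(1 - 1/\<Lambda>) \<Lambda>\<^sup>j\<close>.\<close>

lemma norm_le_half_return:
  assumes "j > 0"
  shows "norm x \<le> 2 * K\<^sup>2 / (1 - inverse \<Lambda>) * inverse (\<Lambda> ^ j) * norm (half_return (2 * j) x)"
proof -
  define c where "c = 1 - inverse \<Lambda>"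
  have c: "c > 0" using \<alpha>_gt_1 by (simp add: c_def field_simps)
  have gap: "c * \<Lambda> ^ j \<le> \<Lambda> ^ j - inverse (\<Lambda> ^ j)"
  proof -
    have "inverse (\<Lambda> ^ j) \<le> 1" by (rule inverse_\<Lambda>_pow_le_1)
    also have "1 \<le> inverse \<Lambda> * \<Lambda> ^ j"
      using \<Lambda>_pow_ge_1[of "j - 1"] assms by (cases j) (auto simp: mult.assoc[symmetric])
    finally show ?thesis by (simp add: c_def algebra_simps)
  qed
  let ?n = "norm (half_return (2 * j) x)"
  have "2 * j - 2 * j div 2 = j" by simp
  then have "\<bar>u (half_return (2 * j) x)\<bar> = \<bar>\<alpha> ^ j - inverse (\<alpha> ^ j)\<bar> * \<bar>u x\<bar>"
    "\<bar>s (half_return (2 * j) x)\<bar> = \<bar>\<beta> ^ j - inverse (\<beta> ^ j)\<bar> * \<bar>s x\<bar>"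
    by (simp_all add: u_half_return s_half_return abs_mult)
  moreover have "\<Lambda> ^ j - inverse (\<Lambda> ^ j) \<le> \<bar>\<alpha> ^ j - inverse (\<alpha> ^ j)\<bar>"
    using abs_triangle_ineq2[of "\<alpha> ^ j" "inverse (\<alpha> ^ j)"] by (simp add: power_abs)
  moreover have "\<Lambda> ^ j - inverse (\<Lambda> ^ j) \<le> \<bar>\<beta> ^ j - inverse (\<beta> ^ j)\<bar>"
    using abs_triangle_ineq2[of "inverse (\<beta> ^ j)" "\<beta> ^ j"] by (simp add: abs_pow_\<beta> abs_minus_commute)
  ultimately have "c * \<Lambda> ^ j * \<bar>u x\<bar> \<le> K * ?n" "c * \<Lambda> ^ j * \<bar>s x\<bar> \<le> K * ?n"
    using u_le[of "half_return (2 * j) x"] s_le[of "half_return (2 * j) x"] gap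
    by (smt (verit) mult_right_mono abs_ge_zero)+
  then have "\<bar>u x\<bar> \<le> K * ?n / (c * \<Lambda> ^ j)" "\<bar>s x\<bar> \<le> K * ?n / (c * \<Lambda> ^ j)"
    using c by (simp_all add: pos_le_divide_eq mult.commute)
  then have "norm x \<le> K * (K * ?n / (c * \<Lambda> ^ j) + K * ?n / (c * \<Lambda> ^ j))"
    using norm_le[of x] K_pos by (meson add_mono mult_left_mono less_imp_le order_trans)
  also have "\<dots> = 2 * K\<^sup>2 / c * inverse (\<Lambda> ^ j) * ?n"
    by (simp add: power2_eq_square divide_inverse algebra_simps)
  finally show ?thesis by (simp add: c_def)
qed

text \<open>A periodic open set that contains every point whose ball of radius \<open>r\<close> returns at time \<open>k\<close>. Any
  constant above \<open>8 * K\<^sup>2\<close> serves to get the strict inequality in the next lemma.\<close>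

definition return_set :: "nat \<Rightarrow> real \<Rightarrow> (real^2) set" where
  "return_set k r = half_return k -` near_lattice 0 (9 * K\<^sup>2 * \<Lambda> ^ (k - k div 2) * r)"

text \<open>Here \<open>y\<close> is a point of the ball around \<open>x\<close> whose \<open>k\<close>-th image is, modulo the lattice, in that ball
  too: \<open>half_return k\<close> maps \<open>y\<close> close to the lattice because \<open>f\<^sup>k y\<close> is close to \<open>y - m\<close>, and \<open>x\<close> close to
  the image of \<open>y\<close>.\<close>

lemma return_in_return_set:
  assumes "dist x y < r" "dist x ((f ^^ k) y + m) < r" "m \<in> int_lattice"
  shows "x \<in> return_set k r"
proof -
  let ?j = "k div 2"
  let ?L = "\<Lambda> ^ (k - ?j)"
  have r: "r > 0" using assms(1) zero_le_dist[of x y] by linarith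
  define e where "e = (f ^^ k) y - y + m"
  have e: "norm e \<le> 2 * r"
  proof -
    have "e = (x - y) - (x - ((f ^^ k) y + m))" by (simp add: e_def)
    then show ?thesis using norm_triangle_ineq4[of "x - y" "x - ((f ^^ k) y + m)"] assms by (simp add: dist_norm)
  qed
  have Lj: "\<Lambda> ^ ?j \<le> ?L" using \<alpha>_gt_1 by (intro power_increasing) auto
  have "half_return k x = half_return k y + half_return k (x - y)"
    by (simp add: linear_diff[OF linear_half_return])
  also have "half_return k y = (g ^^ ?j) (e - m)"
    by (simp add: half_return_eq e_def)
  finally have eq: "half_return k x - (0 + - (g ^^ ?j) m) = (g ^^ ?j) e + ((f ^^ (k - ?j)) (x - y) - (g ^^ ?j) (x - y))"
    by (simp add: linear_diff[OF linear_g_pow] half_return_def)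
  have "norm ((g ^^ ?j) e) \<le> 2 * K\<^sup>2 * ?L * (2 * r)"
    using norm_g_pow_le[of ?j e] e Lj K_pos
    by (elim order_trans) (intro mult_mono, auto)
  moreover have "norm ((g ^^ ?j) (x - y)) \<le> 2 * K\<^sup>2 * ?L * r"
    using norm_g_pow_le[of ?j "x - y"] Lj K_pos assms(1) r
    by (elim order_trans) (intro mult_mono, auto simp: dist_norm)
  moreover have "norm ((f ^^ (k - ?j)) (x - y)) \<le> 2 * K\<^sup>2 * ?L * r"
    using norm_f_pow_le[of "k - ?j" "x - y"] K_pos assms(1) r
    by (elim order_trans) (intro mult_mono, auto simp: dist_norm)
  ultimately have "norm (half_return k x - (0 + - (g ^^ ?j) m)) \<le> 8 * K\<^sup>2 * ?L * r"
    unfolding eq by norm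
  also have "\<dots> < 9 * K\<^sup>2 * ?L * r" using K_pos r by (intro mult_strict_right_mono) auto
  finally show ?thesis
    using g_pow_lattice[OF assms(3)] unfolding return_set_def near_lattice_def dist_norm
    by (auto intro!: bexI[of _ "- (g ^^ ?j) m"])
qed

lemma open_return_set: "open (return_set k r)"
  unfolding return_set_def
  by (intro open_vimage open_near_lattice) (simp add: linear_continuous_on linear_linear linear_half_return)

lemma periodic_return_set: "periodic (return_set k r)"
  using half_return_lattice[of k]
  unfolding return_set_def periodic_def
  by (auto simp: linear_add[OF linear_half_return] periodic_iff[OF periodic_near_lattice])

lemma measure_return_set_le:
  assumes "k > 0" "r \<ge> 0"
  shows "measure cube_measure (return_set k r) \<le> 324 * K ^ 4 * r\<^sup>2 * \<Lambda> ^ (k + 1)"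
proof -
  let ?\<rho> = "9 * K\<^sup>2 * \<Lambda> ^ (k - k div 2) * r"
  have "near_lattice 0 ?\<rho> \<in> sets borel" by (intro borel_open open_near_lattice)
  from cube_measure_endomorphism[OF linear_half_return surj_half_return half_return_lattice this periodic_near_lattice]
  have "measure cube_measure (return_set k r) = measure cube_measure (near_lattice (0 :: real^2) ?\<rho>)"
    using assms unfolding return_set_def by (simp add: measure_def)
  also have "\<dots> \<le> 4 * ?\<rho>\<^sup>2"
    using assms by (intro measure_near_lattice_le) auto
  also have "\<dots> = 324 * K ^ 4 * r\<^sup>2 * \<Lambda> ^ (2 * (k - k div 2))"
    by (simp add: power_mult_distrib power_mult mult.commute[of 2] flip: power_mult[of K])
  also have "\<dots> \<le> 324 * K ^ 4 * r\<^sup>2 * \<Lambda> ^ (k + 1)"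
    using \<alpha>_gt_1 by (intro mult_left_mono power_increasing) auto
  finally show ?thesis .
qed

lemma AE_no_early_return:
  assumes a: "0 < a" "a < 2"
  shows "AE x in cube_measure. \<forall>\<^sub>F n in sequentially. \<forall>k\<in>{1..nat \<lfloor>a * real n\<rfloor>}. x \<notin> return_set k (inverse \<Lambda> ^ n)"
proof -
  interpret U: prob_space "cube_measure :: (real^2) measure" by (rule prob_space_cube_measure)
  define b where "b n = nat \<lfloor>a * real n\<rfloor>" for n
  define A where "A n = (\<Union>k\<in>{1..b n}. return_set k (inverse \<Lambda> ^ n))" for n
  define C where "C = 324 * K ^ 4 * \<Lambda>\<^sup>2 / (\<Lambda> - 1)"
  have A: "A n \<in> sets cube_measure" for n
    unfolding A_def by (auto intro!: sets.finite_UN borel_open open_return_set)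
  \<comment> \<open>The geometric sum, up to a constant its last term.\<close>
  have geo: "(\<Sum>k=1..m. \<Lambda> ^ (k + 1)) * (\<Lambda> - 1) \<le> \<Lambda> ^ (m + 2)" for m
    by (induction m) (use \<Lambda>_pow_ge_1[of 2] in \<open>auto simp: algebra_simps\<close>)
  have bound: "measure cube_measure (A n) \<le> C * (\<Lambda> powr (a - 2)) ^ n" for n
  proof -
    have "measure cube_measure (A n) \<le> (\<Sum>k=1..b n. measure cube_measure (return_set k (inverse \<Lambda> ^ n)))"
      unfolding A_def by (intro U.finite_measure_subadditive_finite) (auto intro!: borel_open open_return_set)
    also have "\<dots> \<le> (\<Sum>k=1..b n. 324 * K ^ 4 * (inverse \<Lambda> ^ n)\<^sup>2 * \<Lambda> ^ (k + 1))"
      by (intro sum_mono measure_return_set_le) auto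
    also have "\<dots> = 324 * K ^ 4 * (inverse \<Lambda> ^ n)\<^sup>2 * (\<Sum>k=1..b n. \<Lambda> ^ (k + 1))"
      by (simp add: sum_distrib_left)
    also have "\<dots> \<le> 324 * K ^ 4 * (inverse \<Lambda> ^ n)\<^sup>2 * (\<Lambda> ^ (b n + 2) / (\<Lambda> - 1))"
      using geo[of "b n"] \<alpha>_gt_1 by (intro mult_left_mono) (auto simp: pos_le_divide_eq)
    also have "\<dots> = C * ((inverse \<Lambda> ^ n)\<^sup>2 * \<Lambda> ^ b n)"
      by (simp add: C_def power_add power2_eq_square)
    also have "\<dots> \<le> C * (\<Lambda> powr (a - 2)) ^ n"
    proof (rule mult_left_mono)
      have "\<Lambda> ^ b n = \<Lambda> powr real (b n)" by (simp add: powr_realpow)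
      also have "\<dots> \<le> \<Lambda> powr (a * real n)"
        using a \<alpha>_gt_1 by (intro powr_mono) (auto simp: b_def)
      finally have "(inverse \<Lambda> ^ n)\<^sup>2 * \<Lambda> ^ b n \<le> \<Lambda> powr (- 2 * real n) * \<Lambda> powr (a * real n)"
      proof (rule mult_mono[rotated])
        have "(inverse \<Lambda> ^ n)\<^sup>2 = \<Lambda> powr (- real (2 * n))"
          unfolding powr_minus by (subst powr_realpow) (auto simp: power_inverse power_mult mult.commute)
        then show "(inverse \<Lambda> ^ n)\<^sup>2 \<le> \<Lambda> powr (- 2 * real n)" by simp
      qed auto
      also have "\<dots> = (\<Lambda> powr (a - 2)) ^ n"
        by (subst powr_realpow[symmetric], simp, subst powr_powr, subst powr_add[symmetric])
          (simp add: algebra_simps)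
      finally show "(inverse \<Lambda> ^ n)\<^sup>2 * \<Lambda> ^ b n \<le> (\<Lambda> powr (a - 2)) ^ n" .
      show "0 \<le> C" using \<alpha>_gt_1 by (simp add: C_def)
    qed
    finally show ?thesis .
  qed
  have sm': "summable (\<lambda>n. C * (\<Lambda> powr (a - 2)) ^ n)"
  proof -
    have "\<Lambda> powr (a - 2) < \<Lambda> powr 0" using a \<alpha>_gt_1 by (intro powr_less_mono) auto
    then show ?thesis by (intro summable_mult summable_geometric) auto
  qed
  have sm: "summable (\<lambda>n. measure cube_measure (A n))"
    using bound by (intro summable_comparison_test'[OF sm', of 0]) simp
  have fin: "emeasure cube_measure (A n) < \<infinity>" for n
    using U.emeasure_finite[of "A n"] by (simp add: less_top[symmetric])
  have "AE x in cube_measure. \<forall>\<^sub>F n in sequentially. x \<in> space cube_measure - A n"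
    by (rule borel_cantelli_AE1[OF A fin sm])
  then show ?thesis
  proof eventually_elim
    case (elim x)
    then show ?case by eventually_elim (auto simp: A_def b_def)
  qed
qed

end

section \<open>Topology of the torus\<close>

lemma dist_abs_torus_less:
  "dist (abs_torus x) (abs_torus y) < r \<longleftrightarrow> (\<exists>m\<in>int_lattice. dist x (y + m) < r)"
proof -
  have fibre: "torus_fibre (abs_torus y) = (\<lambda>m. y + m) ` int_lattice"
  proof safe
    fix z assume "abs_torus z = abs_torus y"
    then have "z - y \<in> int_lattice" by (simp add: abs_torus_eq_iff int_lattice_def)
    then have "y + (z - y) \<in> (\<lambda>m. y + m) ` int_lattice" by (rule imageI)
    then show "z \<in> (\<lambda>m. y + m) ` int_lattice" by simp
  qed (auto simp: abs_torus_eq_iff int_lattice_def)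
  have "dist (abs_torus x) (abs_torus y) = setdist {x} (torus_fibre (abs_torus y))"
    unfolding dist_torus_def by (rule setdist_torus_fibre) simp
  moreover have "setdist {x} (torus_fibre (abs_torus y)) < r
      \<longleftrightarrow> (\<exists>z\<in>torus_fibre (abs_torus y). dist x z < r)"
  proof
    assume less: "setdist {x} (torus_fibre (abs_torus y)) < r"
    show "\<exists>z\<in>torus_fibre (abs_torus y). dist x z < r"
    proof (rule ccontr)
      assume "\<not> ?thesis"
      then have "r \<le> setdist {x} (torus_fibre (abs_torus y))"
        using torus_fibre_nonempty[of "abs_torus y"] by (intro le_setdistI) auto
      with less show False by simp
    qed
  next
    assume "\<exists>z\<in>torus_fibre (abs_torus y). dist x z < r"
    then obtain z where "z \<in> torus_fibre (abs_torus y)" "dist x z < r" by blast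
    then show "setdist {x} (torus_fibre (abs_torus y)) < r"
      using setdist_le_dist[of x "{x}" z "torus_fibre (abs_torus y)"] by simp
  qed
  ultimately show ?thesis unfolding fibre by simp
qed

lemma abs_torus_add_lattice [simp]: "m \<in> int_lattice \<Longrightarrow> abs_torus (x + m) = abs_torus x"
  by (simp add: abs_torus_eq_iff int_lattice_def)

lemma dist_abs_torus_le: "dist (abs_torus x) (abs_torus y) \<le> dist x y"
proof (rule field_le_epsilon)
  fix e :: real assume "e > 0"
  then have "dist (abs_torus x) (abs_torus y) < dist x y + e"
    unfolding dist_abs_torus_less by (intro bexI[of _ 0]) auto
  then show "dist (abs_torus x) (abs_torus y) \<le> dist x y + e" by simp
qed

lemma continuous_on_dist_le:
  assumes "\<And>x y. dist (h x) (h y) \<le> dist x y"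
  shows "continuous_on A h"
  unfolding continuous_on_iff using assms by (meson le_less_trans)

lemma continuous_on_abs_torus: "continuous_on A abs_torus"
  by (rule continuous_on_dist_le) (rule dist_abs_torus_le)

lemma compact_UNIV_torus: "compact (UNIV :: ('n::finite) torus set)"
proof -
  have "UNIV = abs_torus ` (cbox 0 1 :: (real^'n) set)"
  proof safe
    fix X :: "'n torus"
    obtain x where x: "abs_torus x = X" using ex_abs_torus by blast
    obtain m where m: "m \<in> int_lattice" "x - m \<in> unit_cube"
      using ex1_translate_unit_cube[of x 0] by auto
    have "X = abs_torus (x - m)"
      using abs_torus_add_lattice[OF m(1), of "x - m"] x by simp
    moreover have "x - m \<in> cbox 0 1"
      using m(2) by (auto simp: unit_cube_def mem_box_cart less_imp_le)
    ultimately show "X \<in> abs_torus ` cbox 0 1" by blast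
  qed auto
  then show ?thesis
    by (metis compact_continuous_image continuous_on_abs_torus compact_cbox)
qed

lemma open_abs_torus_image:
  assumes "open G"
  shows "open (abs_torus ` G)"
  unfolding open_dist
proof
  fix X assume "X \<in> abs_torus ` G"
  then obtain x where x: "X = abs_torus x" "x \<in> G" by blast
  obtain d where d: "d > 0" "\<And>y. dist y x < d \<Longrightarrow> y \<in> G"
    using assms x(2) unfolding open_dist by blast
  have "Y \<in> abs_torus ` G" if "dist Y X < d" for Y
  proof -
    obtain y where y: "abs_torus y = Y" using ex_abs_torus by blast
    have "\<exists>m\<in>int_lattice. dist x (y + m) < d"
    proof -
      have "dist (abs_torus x) (abs_torus y) < d" using that by (simp only: x(1) y dist_commute)
      then show ?thesis unfolding dist_abs_torus_less .
    qed
    then obtain m where m: "m \<in> int_lattice" "dist x (y + m) < d" by blast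
    then have "y + m \<in> G" using d(2) by (simp add: dist_commute)
    then show ?thesis using m(1) y by (metis abs_torus_add_lattice imageI)
  qed
  then show "\<exists>d>0. \<forall>Y. dist Y X < d \<longrightarrow> Y \<in> abs_torus ` G" using d(1) by blast
qed

lemma abs_torus_in_image_iff: "periodic G \<Longrightarrow> abs_torus x \<in> abs_torus ` G \<longleftrightarrow> x \<in> G"
proof safe
  fix y assume G: "periodic G" "y \<in> G" "abs_torus x = abs_torus y"
  then have "x - y \<in> int_lattice" by (simp add: abs_torus_eq_iff int_lattice_def)
  then have "y + (x - y) \<in> G" using G unfolding periodic_def by blast
  then show "x \<in> G" by simp
qed auto

section \<open>Lower bounds for entropy\<close>

lemma partition_entropy_ge:
  assumes "prob_space M" and J: "finite J" "J \<subseteq> sets M" "space M \<subseteq> \<Union>J"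
    and c: "0 < c" "c \<le> 1" and small: "\<And>A. A \<in> J \<Longrightarrow> measure M A \<le> c"
  shows "- ln c \<le> partition_entropy M J"
proof -
  interpret prob_space M by fact
  have "1 = prob (space M)" by (simp add: prob_space)
  also have "\<dots> \<le> prob (\<Union>J)" using J by (intro finite_measure_mono) auto
  also have "\<dots> \<le> (\<Sum>A\<in>J. prob A)"
    using J finite_measure_subadditive_finite[of J id] by auto
  finally have "1 * (- ln c) \<le> (\<Sum>A\<in>J. prob A) * (- ln c)"
    using c by (intro mult_right_mono) auto
  also have "\<dots> \<le> (\<Sum>A\<in>J. - (prob A * ln (prob A)))"
    unfolding sum_distrib_right
  proof (rule sum_mono)
    fix A assume A: "A \<in> J"
    show "prob A * (- ln c) \<le> - (prob A * ln (prob A))"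
    proof (cases "prob A = 0")
      case False
      then have "0 < prob A" using measure_nonneg[of M A] by linarith
      then have "ln (prob A) \<le> ln c" using small[OF A] by simp
      then show ?thesis using \<open>0 < prob A\<close> by (simp add: mult_left_mono)
    qed simp
  qed
  finally show ?thesis by (simp add: partition_entropy_def sum_negf)
qed

lemma iterated_join_cell_subset:
  assumes "A \<in> iterated_join M T P n" "i < n"
  obtains C where "C \<in> P" "A \<subseteq> (T ^^ i) -` C"
proof -
  have "(\<lambda>C. (T ^^ i) -` C \<inter> space M) ` P \<in> (\<lambda>i. (\<lambda>C. (T ^^ i) -` C \<inter> space M) ` P) ` {..<n}"
    using assms(2) by blast
  from common_refinement_exists[OF assms(1)[unfolded iterated_join_def] this]
  show ?thesis using that by blast
qed

lemma iterated_join_cover: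
  assumes P: "P \<in> finite_partitions M" and T: "T \<in> measurable M M" and n: "n > 0"
  shows "finite (iterated_join M T P n)" "iterated_join M T P n \<subseteq> sets M"
    "space M \<subseteq> \<Union>(iterated_join M T P n)"
proof -
  define \<P> where "\<P> = (\<lambda>i. (\<lambda>C. (T ^^ i) -` C \<inter> space M) ` P) ` {..<n}"
  have J: "iterated_join M T P n = common_refinement \<P>" by (simp add: iterated_join_def \<P>_def)
  have P': "finite P" "P \<subseteq> sets M" "\<Union>P = space M"
    using P by (auto simp: finite_partitions_def partition_on_def)
  have Tn: "(T ^^ i) \<in> measurable M M" for i
    by (induction i) (auto intro: measurable_compose[OF _ T])
  have \<P>: "finite \<P>" "\<P> \<noteq> {}" "\<And>Q. Q \<in> \<P> \<Longrightarrow> finite Q" "\<And>Q. Q \<in> \<P> \<Longrightarrow> Q \<subseteq> sets M"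
    using P' n measurable_sets[OF Tn] by (auto simp: \<P>_def)
  show "finite (iterated_join M T P n)"
    unfolding J common_refinement_def using \<P> by (auto intro!: finite_PiE)
  show "iterated_join M T P n \<subseteq> sets M"
  proof
    fix A assume "A \<in> iterated_join M T P n"
    then obtain h where h: "h \<in> (\<Pi>\<^sub>E Q\<in>\<P>. Q)" "A = \<Inter> (h ` \<P>)"
      unfolding J common_refinement_def by blast
    have "h Q \<in> sets M" if "Q \<in> \<P>" for Q
      using PiE_mem[OF h(1) that] \<P>(4)[OF that] by blast
    then show "A \<in> sets M" unfolding h(2) using \<P> by (intro sets.finite_INT) auto
  qed
  show "space M \<subseteq> \<Union>(iterated_join M T P n)"
    unfolding J Union_common_refinement
  proof safe
    fix x Q assume x: "x \<in> space M" and "Q \<in> \<P>"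
    then obtain i where Q: "Q = (\<lambda>C. (T ^^ i) -` C \<inter> space M) ` P" by (auto simp: \<P>_def)
    have "(T ^^ i) x \<in> \<Union>P" using measurable_space[OF Tn x] P' by simp
    then show "x \<in> \<Union>Q" using x by (auto simp: Q)
  qed
qed

lemma ks_entropy_ge:
  assumes "prob_space M" and P: "P \<in> finite_partitions M" and T: "T \<in> measurable M M"
    and q: "0 < q" "q < 1" and C: "0 < C"
    and small: "\<And>n A. n > 0 \<Longrightarrow> A \<in> iterated_join M T P n \<Longrightarrow> measure M A \<le> C * q ^ n"
  shows "ereal (- ln q) \<le> ks_entropy M T"
proof -
  have lim: "(\<lambda>n. C * q ^ n) \<longlonglongrightarrow> 0"
    using tendsto_mult_left[OF LIMSEQ_power_zero, of q C] q by simp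
  have ev: "\<forall>\<^sub>F n in sequentially. - ln q - ln C / real n
      \<le> partition_entropy M (iterated_join M T P n) / real n"
    using order_tendstoD(2)[OF lim, of 1, simplified] eventually_gt_at_top[of 0]
  proof eventually_elim
    case (elim n)
    have "- ln (C * q ^ n) \<le> partition_entropy M (iterated_join M T P n)"
      using elim q C small iterated_join_cover[OF P T]
      by (intro partition_entropy_ge[OF assms(1)]) auto
    then have "(- ln (C * q ^ n)) / n \<le> partition_entropy M (iterated_join M T P n) / n"
      by (rule divide_right_mono) simp
    moreover have "(- ln (C * q ^ n)) / n = - ln q - ln C / n"
      using q C elim by (simp add: ln_mult ln_realpow field_simps)
    ultimately show ?case by simp
  qed
  have "(\<lambda>n. - ln q - ln C * inverse (real n)) \<longlonglongrightarrow> - ln q - ln C * 0"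
    by (intro tendsto_intros lim_inverse_n)
  then have "(\<lambda>n. ereal (- ln q - ln C / real n)) \<longlonglongrightarrow> ereal (- ln q)"
    by (simp add: divide_inverse)
  then have "ereal (- ln q) = limsup (\<lambda>n. ereal (- ln q - ln C / real n))"
    by (intro lim_imp_Limsup[symmetric]) auto
  also have "\<dots> \<le> ks_entropy_partition M T P"
    unfolding ks_entropy_partition_def using ev by (intro Limsup_mono) (auto elim: eventually_mono)
  also have "\<dots> \<le> ks_entropy M T"
    unfolding ks_entropy_def by (rule SUP_upper[OF P])
  finally show ?thesis .
qed

text \<open>Obtained from a finite cover by balls of radius \<open>\<delta> / 2\<close>, made disjoint.\<close>

lemma compact_small_partition:
  fixes M :: "'a::metric_space measure"
  assumes "compact (UNIV :: 'a set)" "sets M = sets borel" "\<delta> > 0"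
  obtains P where "P \<in> finite_partitions M" "\<And>C x y. C \<in> P \<Longrightarrow> x \<in> C \<Longrightarrow> y \<in> C \<Longrightarrow> dist x y < \<delta>"
proof -
  have sp: "space M = UNIV" using sets_eq_imp_space_eq[OF assms(2)] by simp
  obtain F where F: "finite F" "UNIV \<subseteq> (\<Union>c\<in>F. ball (c::'a) (\<delta> / 2))"
  proof (rule compactE_image[OF assms(1)])
    show "UNIV \<subseteq> (\<Union>c\<in>UNIV. ball (c::'a) (\<delta> / 2))"
    proof
      fix x :: 'a
      show "x \<in> (\<Union>c\<in>UNIV. ball (c::'a) (\<delta> / 2))"
        using assms(3) by (intro UN_I[of x]) simp_all
    qed
  qed auto
  obtain l where l: "set l = F" using F(1) finite_list by blast
  define B where "B i = ball (l ! i) (\<delta> / 2) - (\<Union>j<i. ball (l ! j) (\<delta> / 2))" for i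
  define P where "P = B ` {..<length l} - {{}}"
  show thesis
  proof
    have B_sets: "B i \<in> sets M" for i
      unfolding B_def assms(2) by (intro sets.Diff sets.finite_UN borel_open) auto
    have B_cover: "\<exists>i<length l. x \<in> B i" for x
    proof -
      define H where "H i \<longleftrightarrow> i < length l \<and> x \<in> ball (l ! i) (\<delta> / 2)" for i
      obtain c where c: "c \<in> set l" "x \<in> ball c (\<delta> / 2)"
        using F(2) l by blast
      then have "\<exists>i. H i" by (auto simp: H_def in_set_conv_nth)
      then obtain i where i: "H i" "\<And>j. j < i \<Longrightarrow> \<not> H j"
        using exists_least_iff[of H] by blast
      have "j < length l" if "j < i" for j
        using i(1) that by (simp add: H_def)
      with i have "x \<in> B i"
        by (simp add: B_def H_def)
      then show ?thesis using i(1) by (auto simp: H_def)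
    qed
    have B_disj: "B i \<inter> B j = {}" if "i \<noteq> j" for i j
    proof (cases "i < j")
      case True
      then show ?thesis by (auto simp: B_def)
    next
      case False
      then have "j < i" using that by simp
      then show ?thesis by (auto simp: B_def)
    qed
    have "partition_on UNIV P"
    proof (rule partition_onI)
      show "\<Union>P = UNIV" using B_cover unfolding P_def by blast
      show "disjnt p q" if "p \<in> P" "q \<in> P" "p \<noteq> q" for p q
      proof -
        obtain i j where "p = B i" "q = B j" using \<open>p \<in> P\<close> \<open>q \<in> P\<close> by (auto simp: P_def)
        then show ?thesis using B_disj[of i j] \<open>p \<noteq> q\<close> by (auto simp: disjnt_def)
      qed
      show "{} \<notin> P" by (simp add: P_def)
    qed
    moreover have "P \<subseteq> sets M" using B_sets by (auto simp: P_def)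
    ultimately show "P \<in> finite_partitions M"
      by (simp add: finite_partitions_def sp P_def)
    show "dist x y < \<delta>" if xy: "C \<in> P" "x \<in> C" "y \<in> C" for C x y
    proof -
      obtain c where "x \<in> ball c (\<delta> / 2)" "y \<in> ball c (\<delta> / 2)"
        using xy unfolding P_def B_def by blast
      then show ?thesis by (metis dist_commute dist_triangle_half_r mem_ball)
    qed
  qed
qed

section \<open>The measure on an embedded torus\<close>

text \<open>If the orbits of two points whose difference lifts to \<open>v\<close> stay close on the torus up to time \<open>n\<close>,
  then one lattice vector realizes all the small distances: the integral vectors of two
  consecutive times differ by a lattice vector of norm less than \<open>1\<close>.\<close>

lemma (in hyperbolic_lattice_map) bowen_ball_lift:
  fixes v :: "real^2"
  defines "\<delta> \<equiv> inverse (2 * K\<^sup>2 * \<Lambda> + 1)"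
  assumes n: "n > 0" and close: "\<And>i. i < n \<Longrightarrow> \<exists>m\<in>int_lattice. norm ((f ^^ i) v - m) < \<delta>"
  shows "\<exists>m\<in>int_lattice. \<forall>i<n. norm ((f ^^ i) (v - m)) < \<delta>"
proof -
  have d: "\<delta> > 0" using K_pos \<alpha>_gt_1 unfolding \<delta>_def by (intro positive_imp_inverse_positive add_nonneg_pos) auto
  have d1: "(2 * K\<^sup>2 * \<Lambda> + 1) * \<delta> = 1"
    using d unfolding \<delta>_def by (metis inverse_nonzero_iff_nonzero less_irrefl right_inverse)
  obtain m where m: "m \<in> int_lattice" "norm ((f ^^ 0) v - m) < \<delta>" using close[OF n] by blast
  have "norm ((f ^^ i) (v - m)) < \<delta>" if "i < n" for i
    using that
  proof (induction i)
    case 0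
    then show ?case using m by simp
  next
    case (Suc i)
    let ?w = "(f ^^ Suc i) (v - m)"
    have IH: "norm ((f ^^ i) (v - m)) < \<delta>" using Suc by simp
    have "norm ?w \<le> 2 * K\<^sup>2 * \<Lambda> * norm ((f ^^ i) (v - m))"
      using norm_f_pow_le[of 1 "(f ^^ i) (v - m)"] by simp
    also have "\<dots> \<le> 2 * K\<^sup>2 * \<Lambda> * \<delta>"
      using IH by (intro mult_left_mono) auto
    finally have w: "norm ?w \<le> 2 * K\<^sup>2 * \<Lambda> * \<delta>" .
    obtain k where k: "k \<in> int_lattice" "norm ((f ^^ Suc i) v - k) < \<delta>" using close Suc by blast
    let ?l = "k - (f ^^ Suc i) m"
    have wl: "?w - ?l = (f ^^ Suc i) v - k"
      by (simp only: linear_diff[OF linear_f_pow]) (simp add: algebra_simps)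
    have "norm ?l \<le> norm ?w + norm (?w - ?l)" by norm
    also have "\<dots> < (2 * K\<^sup>2 * \<Lambda> + 1) * \<delta>"
      using w k(2) wl by (simp only: distrib_right mult_1)
    finally have "norm ?l < 1" using d1 by simp
    moreover have "?l \<in> int_lattice" using k m by (intro int_lattice_diff f_pow_lattice)
    ultimately have "?l = 0" by (intro int_lattice_eq_0)
    then show ?case using k(2) wl by (simp only: diff_zero)
  qed
  then show ?thesis using m by blast
qed

text \<open>At the middle time the unstable coordinate is still small, as it has to expand until time
  \<open>n - 1\<close>, and the stable one is already contracted.\<close>

lemma (in hyperbolic_lattice_map) bowen_ball_contracted:
  assumes n: "n > 0" and small: "\<And>i. i < n \<Longrightarrow> norm ((f ^^ i) v) < \<delta>"
  shows "norm ((f ^^ ((n - 1) div 2)) v) < 3 * K\<^sup>2 * \<delta> * inverse (\<Lambda> ^ ((n - 1) div 2))"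
proof -
  define j where "j = (n - 1) div 2"
  have d: "\<delta> > 0" using small[OF n] norm_ge_zero[of "(f ^^ 0) v"] by linarith
  have 1: "\<bar>s ((f ^^ j) v)\<bar> \<le> K * \<delta> * inverse (\<Lambda> ^ j)"
  proof -
    have "\<bar>s v\<bar> \<le> K * \<delta>" using s_le[of v] small[OF n] K_pos
      by simp (meson less_imp_le mult_left_mono order_trans)
    then show ?thesis by (simp add: abs_mult abs_pow_\<beta> mult.commute mult_left_mono)
  qed
  have 2: "\<bar>u ((f ^^ j) v)\<bar> \<le> K * \<delta> * inverse (\<Lambda> ^ j)"
  proof -
    have "\<bar>u ((f ^^ (n - 1)) v)\<bar> \<le> K * \<delta>"
      using u_le[of "(f ^^ (n - 1)) v"] small[of "n - 1"] n K_pos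
      by (meson diff_less less_imp_le less_numeral_extra(1) mult_left_mono order_trans)
    then have a: "\<Lambda> ^ (n - 1) * \<bar>u v\<bar> \<le> K * \<delta>" by (simp add: abs_mult power_abs)
    have "\<Lambda> ^ j * (\<Lambda> ^ j * \<bar>u v\<bar>) \<le> \<Lambda> ^ (n - 1) * \<bar>u v\<bar>"
      unfolding mult.assoc[symmetric] power_add[symmetric]
      using \<alpha>_gt_1 by (intro mult_right_mono power_increasing) (auto simp: j_def)
    with a have "\<Lambda> ^ j * (\<Lambda> ^ j * \<bar>u v\<bar>) \<le> K * \<delta>" by linarith
    then have "\<Lambda> ^ j * \<bar>u v\<bar> \<le> K * \<delta> / \<Lambda> ^ j"
      by (simp add: pos_le_divide_eq mult.commute)
    then show ?thesis by (simp add: abs_mult power_abs divide_inverse)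
  qed
  have "norm ((f ^^ j) v) \<le> K * (K * \<delta> * inverse (\<Lambda> ^ j) + K * \<delta> * inverse (\<Lambda> ^ j))"
    using norm_le[of "(f ^^ j) v"] 1 2 K_pos by (meson add_mono mult_left_mono less_imp_le order_trans)
  also have "\<dots> = 2 * (K\<^sup>2 * \<delta> * inverse (\<Lambda> ^ j))" by (simp add: power2_eq_square algebra_simps)
  also have "\<dots> < 3 * (K\<^sup>2 * \<delta> * inverse (\<Lambda> ^ j))"
    using d K_pos by (intro mult_strict_right_mono) auto
  finally show ?thesis by (simp add: j_def mult.assoc)
qed

text \<open>A dynamical system \<open>T\<close> on a compact metric space that contains an isometric copy \<open>e\<close> of the
  hyperbolic automorphism \<open>t\<close> of the 2-torus and has \<open>t\<close> as a factor by a 1-Lipschitz retraction \<open>p\<close>.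
  The two coordinate slices through \<open>0\<close> of a direct product are of this kind.\<close>

locale embedded_torus_automorphism = hyperbolic_lattice_map +
  fixes t :: "2 torus \<Rightarrow> 2 torus" and T :: "'a::metric_space \<Rightarrow> 'a"
    and e :: "2 torus \<Rightarrow> 'a" and p :: "'a \<Rightarrow> 2 torus"
  assumes t_abs: "t (abs_torus x) = abs_torus (f x)"
    and continuous_T: "continuous_on UNIV T"
    and dist_e [simp]: "dist (e X) (e Y) = dist X Y"
    and dist_p_le: "dist (p z) (p w) \<le> dist z w"
    and p_e [simp]: "p (e X) = X"
    and T_e [simp]: "T (e X) = e (t X)" and p_T [simp]: "p (T z) = t (p z)"
    and compact_space: "compact (UNIV :: 'a set)"
begin

text \<open>The parametrization of the embedded torus by the plane.\<close>

definition \<phi> :: "real^2 \<Rightarrow> 'a" where "\<phi> x = e (abs_torus x)"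

text \<open>Haar measure of the 2-torus, carried over to its copy.\<close>

definition \<mu> :: "'a measure" where "\<mu> = distr cube_measure borel \<phi>"

lemma T_pow_e [simp]: "(T ^^ n) (e X) = e ((t ^^ n) X)"
  by (induction n) simp_all

lemma p_T_pow [simp]: "p ((T ^^ n) z) = (t ^^ n) (p z)"
  by (induction n) simp_all

lemma t_pow_abs [simp]: "(t ^^ n) (abs_torus x) = abs_torus ((f ^^ n) x)"
  by (induction n) (simp_all add: t_abs)

lemma T_\<phi>: "T (\<phi> x) = \<phi> (f x)"
  by (simp add: \<phi>_def t_abs)

lemma borel_T [measurable]: "T \<in> borel_measurable borel"
  using continuous_T by (rule borel_measurable_continuous_onI)

lemma continuous_e: "continuous_on UNIV e" and continuous_p: "continuous_on UNIV p"
  by (auto intro!: continuous_on_dist_le simp: dist_p_le)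

lemma borel_p [measurable]: "p \<in> borel_measurable borel"
  using continuous_p by (rule borel_measurable_continuous_onI)

lemma borel_\<phi> [measurable]: "\<phi> \<in> borel_measurable borel"
  unfolding \<phi>_def
  by (rule borel_measurable_continuous_onI)
    (auto intro!: continuous_on_dist_le dist_abs_torus_le)

lemma sets_\<mu> [simp, measurable_cong]: "sets \<mu> = sets borel" and space_\<mu> [simp]: "space \<mu> = UNIV"
  by (simp_all add: \<mu>_def)

lemma emeasure_\<mu>:
  "E \<in> sets borel \<Longrightarrow> emeasure \<mu> E = emeasure cube_measure (\<phi> -` E)"
  unfolding \<mu>_def by (subst emeasure_distr) auto

lemma \<phi>_vimage:
  assumes "E \<in> sets borel"
  shows "\<phi> -` E \<in> sets borel" "periodic (\<phi> -` E)"
  using measurable_sets[OF borel_\<phi> assms] by (auto simp: periodic_def \<phi>_def)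

lemma prob_space_\<mu>: "prob_space \<mu>"
  unfolding \<mu>_def by (intro prob_space.prob_space_distr prob_space_cube_measure) simp

lemma invariant_\<mu>: "invariant_measure \<mu> T"
  unfolding invariant_measure_def
proof
  show Tm: "T \<in> measurable \<mu> \<mu>" by simp
  show "distr \<mu> \<mu> T = \<mu>"
  proof (rule measure_eqI)
    fix E assume "E \<in> sets (distr \<mu> \<mu> T)"
    then have E: "E \<in> sets borel" by simp
    have "\<phi> -` T -` E = f -` \<phi> -` E" by (auto simp: T_\<phi>)
    then show "emeasure (distr \<mu> \<mu> T) E = emeasure \<mu> E"
      using E measurable_sets[OF borel_T E] Tm cube_measure_endomorphism[OF linear_f surj_f f_lattice \<phi>_vimage[OF E]]
      by (simp add: emeasure_distr emeasure_\<mu>)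
  qed simp
qed

lemma ergodic_\<mu>: "ergodic_measure \<mu> T"
  unfolding ergodic_measure_def
proof (intro conjI ballI impI invariant_\<mu>)
  fix E assume "E \<in> sets \<mu>" and inv: "T -` E \<inter> space \<mu> = E"
  then have E: "E \<in> sets borel" by simp
  have "f -` \<phi> -` E = \<phi> -` E" using inv by (auto simp flip: T_\<phi>)
  from ergodic_cube_measure[OF \<phi>_vimage[OF E] this]
  show "measure \<mu> E = 0 \<or> measure \<mu> E = 1" using E by (simp add: measure_def emeasure_\<mu>)
qed

lemma ks_entropy_\<mu>: "ks_entropy \<mu> T > 0"
proof -
  interpret U: prob_space "cube_measure :: (real^2) measure" by (rule prob_space_cube_measure)
  define \<delta> where "\<delta> = inverse (2 * K\<^sup>2 * \<Lambda> + 1)"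
  define C where "C = 36 * K ^ 4 * \<delta>\<^sup>2 * \<Lambda>\<^sup>2"
  have d: "\<delta> > 0" using K_pos \<alpha>_gt_1 unfolding \<delta>_def by (intro positive_imp_inverse_positive add_nonneg_pos) auto
  obtain P where P: "P \<in> finite_partitions \<mu>"
    "\<And>C x y. C \<in> P \<Longrightarrow> x \<in> C \<Longrightarrow> y \<in> C \<Longrightarrow> dist x y < \<delta>"
    using compact_small_partition[OF compact_space sets_\<mu> d] by blast
  have "ereal (- ln (inverse \<Lambda>)) \<le> ks_entropy \<mu> T"
  proof (rule ks_entropy_ge[OF prob_space_\<mu> P(1)])
    show "T \<in> measurable \<mu> \<mu>" by simp
    show "0 < inverse \<Lambda>" "inverse \<Lambda> < 1" using \<alpha>_gt_1 by (auto simp: inverse_less_1_iff)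
    show "0 < C" using d K_pos by (simp add: C_def)
    fix n :: nat and A assume n: "n > 0" and A: "A \<in> iterated_join \<mu> T P n"
    have A_sets: "A \<in> sets borel"
      using iterated_join_cover(2)[OF P(1) _ n, of T] A by auto
    define j where "j = (n - 1) div 2"
    define \<rho> where "\<rho> = 3 * K\<^sup>2 * \<delta> * inverse (\<Lambda> ^ j)"
    have \<rho>: "\<rho> \<ge> 0" using d by (simp add: \<rho>_def)
    have "measure cube_measure (\<phi> -` A) \<le> 4 * \<rho>\<^sup>2"
    proof (cases "\<phi> -` A = {}")
      case False
      then obtain x where x: "\<phi> x \<in> A" by blast
      have "\<phi> -` A \<subseteq> (f ^^ j) -` near_lattice ((f ^^ j) x) \<rho>"
      proof
        fix y assume "y \<in> \<phi> -` A"
        then have y: "\<phi> y \<in> A" by simp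
        have "\<exists>m\<in>int_lattice. norm ((f ^^ i) (y - x) - m) < \<delta>" if i: "i < n" for i
        proof -
          obtain C where "C \<in> P" "A \<subseteq> (T ^^ i) -` C"
            by (rule iterated_join_cell_subset[OF A i])
          then have "dist ((T ^^ i) (\<phi> y)) ((T ^^ i) (\<phi> x)) < \<delta>" using x y P(2) by blast
          then have "dist (abs_torus ((f ^^ i) y)) (abs_torus ((f ^^ i) x)) < \<delta>" by (simp add: \<phi>_def)
          then show ?thesis
            unfolding dist_abs_torus_less by (simp add: dist_norm linear_diff[OF linear_f_pow] algebra_simps)
        qed
        then obtain m where m: "m \<in> int_lattice" "\<And>i. i < n \<Longrightarrow> norm ((f ^^ i) (y - x - m)) < \<delta>"
          using bowen_ball_lift[OF n, of "y - x"] unfolding \<delta>_def by blast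
        have "norm ((f ^^ j) (y - x - m)) < \<rho>"
          using bowen_ball_contracted[OF n m(2)] by (simp add: \<rho>_def j_def)
        moreover have "(f ^^ j) (y - x - m) = (f ^^ j) y - ((f ^^ j) x + (f ^^ j) m)"
          by (simp only: linear_diff[OF linear_f_pow] linear_add[OF linear_f_pow] diff_diff_eq)
        ultimately have "dist ((f ^^ j) y) ((f ^^ j) x + (f ^^ j) m) < \<rho>"
          by (simp only: dist_norm)
        then show "y \<in> (f ^^ j) -` near_lattice ((f ^^ j) x) \<rho>"
          using f_pow_lattice[OF m(1)] by (auto simp: near_lattice_def)
      qed
      moreover have eq: "emeasure cube_measure ((f ^^ j) -` near_lattice ((f ^^ j) x) \<rho>)
          = emeasure cube_measure (near_lattice ((f ^^ j) x) \<rho>)"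
      proof (rule cube_measure_endomorphism)
        show "surj (f ^^ j)" by (rule surjI[of _ "g ^^ j"]) simp
        show "(f ^^ j) ` int_lattice \<subseteq> int_lattice" using f_pow_lattice by auto
      qed (auto intro: linear_f_pow periodic_near_lattice borel_open open_near_lattice)
      moreover have "(f ^^ j) -` near_lattice ((f ^^ j) x) \<rho> \<in> sets borel"
        by (intro borel_open open_vimage open_near_lattice)
          (simp add: linear_continuous_on linear_linear linear_f_pow)
      ultimately have "measure cube_measure (\<phi> -` A) \<le> measure cube_measure (near_lattice ((f ^^ j) x) \<rho>)"
        using U.finite_measure_mono[of "\<phi> -` A" "(f ^^ j) -` near_lattice ((f ^^ j) x) \<rho>"]
        by (simp add: measure_def)
      also have "\<dots> \<le> 4 * \<rho>\<^sup>2" by (rule measure_near_lattice_le[OF \<rho>])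
      finally show ?thesis .
    qed simp
    also have "4 * \<rho>\<^sup>2 = 36 * K ^ 4 * \<delta>\<^sup>2 * inverse \<Lambda> ^ (2 * j)"
    proof -
      have "(inverse (\<Lambda> ^ j))\<^sup>2 = inverse \<Lambda> ^ (2 * j)" by (simp only: power_even_eq power_inverse)
      moreover have "(K\<^sup>2)\<^sup>2 = K ^ 4" by simp
      ultimately show ?thesis by (simp only: \<rho>_def power_mult_distrib) simp
    qed
    also have "\<dots> \<le> 36 * K ^ 4 * \<delta>\<^sup>2 * (\<Lambda>\<^sup>2 * inverse \<Lambda> ^ n)"
    proof (rule mult_left_mono)
      have "inverse \<Lambda> ^ (2 * j) = \<Lambda>\<^sup>2 * inverse \<Lambda> ^ (2 * j + 2)"
      proof -
        have "\<Lambda>\<^sup>2 * (inverse \<Lambda>)\<^sup>2 = (\<Lambda> * inverse \<Lambda>)\<^sup>2" by (rule power_mult_distrib[symmetric])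
        also have "\<dots> = 1" by simp
        finally show ?thesis by (simp only: power_add mult.left_commute[of "\<Lambda>\<^sup>2"] mult_1_right)
      qed
      also have "\<dots> \<le> \<Lambda>\<^sup>2 * inverse \<Lambda> ^ n"
        using \<alpha>_gt_1 by (intro mult_left_mono power_decreasing) (auto simp: j_def inverse_le_1_iff)
      finally show "inverse \<Lambda> ^ (2 * j) \<le> \<Lambda>\<^sup>2 * inverse \<Lambda> ^ n" .
    qed auto
    finally show "measure \<mu> A \<le> C * inverse \<Lambda> ^ n"
      using A_sets by (simp add: measure_def emeasure_\<mu> C_def mult.assoc)
  qed
  moreover have "0 < - ln (inverse \<Lambda>)" using \<alpha>_gt_1 by (simp add: ln_inverse)
  ultimately show ?thesis by (metis ereal_less(2) less_le_trans)
qed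

section \<open>Return times of balls\<close>

text \<open>The times at which the ball of radius \<open>r\<close> around \<open>z\<close> meets its image.\<close>

definition returns :: "'a \<Rightarrow> real \<Rightarrow> nat set" where
  "returns z r = {k. k > 0 \<and> (T ^^ k) ` ball z r \<inter> ball z r \<noteq> {}}"

lemma return_time_eq: "return_time T (ball z r) = Inf (returns z r)"
  by (simp add: return_time_def returns_def)

lemma returns_mono: "r \<le> r' \<Longrightarrow> returns z r \<subseteq> returns z r'"
  unfolding returns_def using subset_ball[of r r' z] by blast

lemma returns_imp_return_set:
  assumes "k \<in> returns (\<phi> x) r"
  shows "x \<in> return_set k r"
proof -
  obtain w where w: "dist (\<phi> x) w < r" "dist (\<phi> x) ((T ^^ k) w) < r"
    using assms unfolding returns_def by (auto simp: mem_ball)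
  obtain y0 where y0: "abs_torus y0 = p w" using ex_abs_torus by blast
  have "dist (abs_torus x) (abs_torus y0) < r"
    using w(1) dist_p_le[of "\<phi> x" w] by (simp add: \<phi>_def y0)
  then obtain l where l: "l \<in> int_lattice" "dist x (y0 + l) < r" unfolding dist_abs_torus_less by blast
  have "(t ^^ k) (p w) = abs_torus ((f ^^ k) (y0 + l))"
    using l y0 by (simp flip: t_pow_abs)
  then have "dist (abs_torus x) (abs_torus ((f ^^ k) (y0 + l))) < r"
    using w(2) dist_p_le[of "\<phi> x" "(T ^^ k) w"] by (simp add: \<phi>_def)
  then obtain m where "m \<in> int_lattice" "dist x ((f ^^ k) (y0 + l) + m) < r"
    unfolding dist_abs_torus_less by blast
  then show ?thesis using l(2) by (intro return_in_return_set[of x "y0 + l"])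
qed

text \<open>Twice the constant of \<open>norm_le_half_return\<close>, as every point of the plane is within \<open>2\<close> of the lattice.\<close>

definition D :: real where "D = 4 * K\<^sup>2 / (1 - inverse \<Lambda>)"

lemma D_pos: "D > 0"
  using K_pos \<alpha>_gt_1 by (auto simp: D_def intro!: divide_pos_pos simp: inverse_less_1_iff)

text \<open>The witness is a point \<open>q\<close> of period \<open>2 * j\<close> close to \<open>x\<close>, the preimage of a lattice point next to \<open>half_return (2 * j) x\<close>.\<close>

lemma even_return:
  assumes j: "j > 0" and r: "D * inverse (\<Lambda> ^ j) < r"
  shows "2 * j \<in> returns (\<phi> x) r"
proof -
  let ?N = "half_return (2 * j)"
  obtain m where m: "m \<in> int_lattice" "?N x - m \<in> unit_cube"
    using ex1_translate_unit_cube[of "?N x" 0] by auto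
  obtain q where q: "?N q = m" using surj_half_return[of "2 * j"] j by (metis mult_pos_pos pos2 surjD)
  have "norm (?N x - m) \<le> 2"
  proof -
    have "norm (?N x - m) \<le> (\<Sum>i\<in>UNIV. \<bar>(?N x - m) $ i\<bar>)" by (rule norm_le_l1_cart)
    also have "\<dots> \<le> (\<Sum>i\<in>(UNIV::2 set). 1)"
      using m(2) by (intro sum_mono) (auto simp: unit_cube_def less_imp_le)
    finally show ?thesis by simp
  qed
  then have "norm (?N (x - q)) \<le> 2" by (simp add: linear_diff[OF linear_half_return] q)
  then have "norm (x - q) \<le> 2 * K\<^sup>2 / (1 - inverse \<Lambda>) * inverse (\<Lambda> ^ j) * 2"
    using norm_le_half_return[OF j, of "x - q"] \<alpha>_gt_1
    by (elim order_trans) (intro mult_left_mono mult_nonneg_nonneg divide_nonneg_nonneg, auto simp: inverse_le_1_iff)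
  also have "\<dots> = D * inverse (\<Lambda> ^ j)" by (simp add: D_def)
  finally have xq: "dist x q < r" using r by (simp add: dist_norm)
  have "(f ^^ j) m = (f ^^ j) ((g ^^ j) ((f ^^ (2 * j)) q - q))"
    using q by (simp add: half_return_eq)
  then have "(f ^^ (2 * j)) q = q + (f ^^ j) m" by simp
  then have fix_q: "(T ^^ (2 * j)) (\<phi> q) = \<phi> q"
    using f_pow_lattice[OF m(1)] by (simp add: \<phi>_def)
  have "\<phi> q \<in> ball (\<phi> x) r" using xq dist_abs_torus_le[of x q] by (simp add: \<phi>_def)
  then have "\<phi> q \<in> (T ^^ (2 * j)) ` ball (\<phi> x) r \<inter> ball (\<phi> x) r"
    using fix_q by (metis IntI imageI)
  then have ne: "(T ^^ (2 * j)) ` ball (\<phi> x) r \<inter> ball (\<phi> x) r \<noteq> {}" by blast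
  show ?thesis unfolding returns_def by (rule CollectI, rule conjI[OF _ ne]) (use j in simp)
qed

lemma return_time_le:
  assumes "0 < r" "r < D"
  shows "real (return_time T (ball (\<phi> x) r)) \<le> 2 * ((ln D - ln r) / ln \<Lambda> + 2)"
    and "return_time T (ball (\<phi> x) r) \<in> returns (\<phi> x) r"
proof -
  have l: "ln \<Lambda> > 0" using \<alpha>_gt_1 by simp
  define j where "j = nat \<lceil>(ln D - ln r) / ln \<Lambda>\<rceil> + 1"
  have nn: "0 \<le> (ln D - ln r) / ln \<Lambda>" using assms l by simp
  have j1: "(ln D - ln r) / ln \<Lambda> < real j" and j2: "real j \<le> (ln D - ln r) / ln \<Lambda> + 2"
    using nn unfolding j_def by linarith+
  have "ln D - ln r < real j * ln \<Lambda>" using j1 l by (simp add: pos_divide_less_eq)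
  then have "ln D < ln (r * \<Lambda> ^ j)" using assms by (simp add: ln_mult ln_realpow)
  then have "D < r * \<Lambda> ^ j" using assms D_pos by simp
  then have "D * inverse (\<Lambda> ^ j) < r" by (simp add: field_simps)
  then have ret: "2 * j \<in> returns (\<phi> x) r" by (intro even_return) (simp_all add: j_def)
  have "return_time T (ball (\<phi> x) r) \<le> 2 * j"
    unfolding return_time_eq using ret by (intro cInf_lower) auto
  then have "real (return_time T (ball (\<phi> x) r)) \<le> 2 * real j" by linarith
  also have "\<dots> \<le> 2 * ((ln D - ln r) / ln \<Lambda> + 2)" using j2 by (intro mult_left_mono) auto
  finally show "real (return_time T (ball (\<phi> x) r)) \<le> 2 * ((ln D - ln r) / ln \<Lambda> + 2)" .
  show "return_time T (ball (\<phi> x) r) \<in> returns (\<phi> x) r"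
    unfolding return_time_eq using ret by (intro Inf_nat_def1) auto
qed

text \<open>The hypothesis excludes returns up to time \<open>(2 - \<epsilon>) n\<close> for the radii \<open>\<Lambda>\<^sup>-\<^sup>n\<close>, with \<open>\<epsilon>\<close> from a sequence
  tending to \<open>0\<close>; monotonicity in the radius covers the radii in between.\<close>

lemma return_time_limit:
  assumes no_early: "\<And>i::nat. \<forall>\<^sub>F n in sequentially.
      \<forall>k\<in>{1..nat \<lfloor>(2 - 1 / real (Suc i)) * real n\<rfloor>}. x \<notin> return_set k (inverse \<Lambda> ^ n)"
  shows "((\<lambda>r. real (return_time T (ball (\<phi> x) r)) / (- ln r)) \<longlongrightarrow> 2 / ln \<Lambda>) (at_right 0)"
proof -
  define h where "h = ln \<Lambda>"
  define \<tau> where "\<tau> r = return_time T (ball (\<phi> x) r)" for r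
  have h: "h > 0" using \<alpha>_gt_1 by (simp add: h_def)
  have ln_top: "filterlim (\<lambda>r::real. - ln r) at_top (at_right 0)"
    using ln_at_0 by (simp add: filterlim_uminus_at_top)
  have small: "\<forall>\<^sub>F r in at_right 0. 0 < r \<and> r < min 1 D"
    using D_pos unfolding eventually_at_right_field by (intro exI[of _ "min 1 D"]) auto
  have "((\<lambda>r. real (\<tau> r) / (- ln r)) \<longlongrightarrow> 2 / h) (at_right 0)"
  proof (rule order_tendstoI)
    fix a assume a: "2 / h < a"
    define c where "c = 2 * (ln D / h + 2)"
    have "\<forall>\<^sub>F r in at_right 0. c / (a - 2 / h) < - ln r"
      using ln_top by (simp add: filterlim_at_top_dense)
    with small show "\<forall>\<^sub>F r in at_right 0. real (\<tau> r) / (- ln r) < a"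
    proof eventually_elim
      case (elim r)
      then have l: "- ln r > 0" by simp
      have "real (\<tau> r) \<le> 2 * ((ln D - ln r) / h + 2)"
        using return_time_le(1)[of r x] elim by (simp add: \<tau>_def h_def)
      also have "\<dots> = c + 2 / h * (- ln r)" by (simp add: c_def diff_divide_distrib)
      also have "c < (a - 2 / h) * (- ln r)"
        using elim a by (simp add: pos_divide_less_eq mult.commute)
      finally have "real (\<tau> r) < a * (- ln r)" by (simp add: algebra_simps)
      then show ?case using l by (simp only: pos_divide_less_eq)
    qed
  next
    fix a assume a: "a < 2 / h"
    then have "0 < 2 - a * h" using h by (simp add: field_simps)
    then obtain i where i: "1 / real (Suc i) < 2 - a * h"
      using reals_Archimedean by (metis inverse_eq_divide)
    define c where "c = 2 - 1 / real (Suc i)"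
    have c: "a * h < c" "0 < c" using i by (auto simp: c_def field_simps)
    obtain n0 where n0: "\<And>n k. n \<ge> n0 \<Longrightarrow> k \<in> {1..nat \<lfloor>c * real n\<rfloor>} \<Longrightarrow> x \<notin> return_set k (inverse \<Lambda> ^ n)"
      using no_early[of i] unfolding eventually_sequentially c_def by blast
    have "\<forall>\<^sub>F r in at_right 0. real n0 * h + h < - ln r" "\<forall>\<^sub>F r in at_right 0. c / (c / h - a) < - ln r"
      using ln_top by (simp_all add: filterlim_at_top_dense)
    with small show "\<forall>\<^sub>F r in at_right 0. a < real (\<tau> r) / (- ln r)"
    proof eventually_elim
      case (elim r)
      then have l: "- ln r > 0" by simp
      \<comment> \<open>The largest \<open>n\<close> with \<open>r \<le> \<Lambda>\<^sup>-\<^sup>n\<close>.\<close>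
      define n where "n = nat \<lfloor>- ln r / h\<rfloor>"
      have n: "real n \<le> - ln r / h" "- ln r / h < real n + 1"
      proof -
        have "0 \<le> - ln r / h" using l h by (intro divide_nonneg_pos) auto
        then show "real n \<le> - ln r / h" "- ln r / h < real n + 1"
          unfolding n_def by linarith+
      qed
      have "- ln r < (real n + 1) * h"
        using n(2) h by (simp only: pos_divide_less_eq)
      then have "real n0 * h + h < (real n + 1) * h"
        using elim by linarith
      then have "n0 \<le> n" using h by (simp add: algebra_simps)
      have "real n * h \<le> - ln r" using n(1) h by (simp only: pos_le_divide_eq)
      then have "ln (\<Lambda> ^ n) \<le> ln (1 / r)"
        using elim by (simp add: h_def ln_realpow ln_div)
      then have "\<Lambda> ^ n \<le> 1 / r" using elim by (subst (asm) ln_le_cancel_iff) auto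
      then have "r \<le> inverse \<Lambda> ^ n" using elim by (simp add: field_simps power_inverse)
      then have "\<tau> r \<in> returns (\<phi> x) (inverse \<Lambda> ^ n)"
        using return_time_le(2)[of r x] returns_mono elim unfolding \<tau>_def by auto
      from returns_imp_return_set[OF this] this
      have "x \<in> return_set (\<tau> r) (inverse \<Lambda> ^ n)" "\<tau> r > 0"
        by (simp_all add: returns_def)
      then have "\<not> \<tau> r \<le> nat \<lfloor>c * real n\<rfloor>"
        using n0[OF \<open>n0 \<le> n\<close>, of "\<tau> r"] by auto
      then have "c * real n < real (\<tau> r)" using c by linarith
      moreover have "c * (- ln r / h - 1) \<le> c * real n" using n(2) c by (intro mult_left_mono) auto
      moreover have "a * (- ln r) < c * (- ln r / h - 1)"
      proof -
        have "0 < c / h - a" using c h by (simp add: field_simps)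
        then have "c < (c / h - a) * (- ln r)" using elim by (simp add: pos_divide_less_eq mult.commute)
        then show ?thesis by (simp add: algebra_simps)
      qed
      ultimately have "a * (- ln r) < real (\<tau> r)" by linarith
      then show ?case using l by (simp only: pos_less_divide_eq)
    qed
  qed
  then show ?thesis by (simp add: \<tau>_def h_def)
qed

lemma AE_return_time_limit:
  "AE z in \<mu>. ((\<lambda>r. real (return_time T (ball z r)) / (- ln r)) \<longlongrightarrow> 2 / ln \<Lambda>) (at_right 0)"
proof -
  define G where "G k n = abs_torus ` return_set k (inverse \<Lambda> ^ n)" for k n
  have G [measurable]: "p -` G k n \<in> sets borel" for k n
    using measurable_sets[OF borel_p, of "G k n"] open_abs_torus_image[OF open_return_set] by (simp add: G_def)
  \<comment> \<open>The points satisfying the conclusion need not form a Borel set; the condition \<open>Q\<close>, which implies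
    it, describes a Borel set, so that it can be transported to the image measure.\<close>
  define Q where "Q z \<longleftrightarrow> e (p z) = z \<and> (\<forall>i. \<forall>\<^sub>F n in sequentially.
      \<forall>k\<in>{1..nat \<lfloor>(2 - 1 / real (Suc i)) * real n\<rfloor>}. z \<notin> p -` G k n)" for z
  have "closed {z. e (p z) = z}"
    by (intro closed_Collect_eq continuous_on_compose2[OF continuous_e continuous_p] continuous_on_id) auto
  then have cl [measurable]: "{z. e (p z) = z} \<in> sets borel" by (rule borel_closed)
  have Q_sets: "{z \<in> space borel. Q z} \<in> sets borel"
  proof -
    define E where "E i n = (\<Union>k\<in>{1..nat \<lfloor>(2 - 1 / real (Suc i)) * real n\<rfloor>}. p -` G k n)" for i n :: nat
    have E [measurable]: "E i n \<in> sets borel" for i n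
      unfolding E_def by (intro sets.finite_UN G) auto
    have "Q z \<longleftrightarrow> e (p z) = z \<and> (\<forall>i. \<exists>N. \<forall>n\<ge>N. z \<notin> E i n)" for z
      by (simp add: Q_def E_def eventually_sequentially)
    then have "{z \<in> space borel. Q z} = {z. e (p z) = z} \<inter> (\<Inter>i. \<Union>N. - (\<Union>n\<in>{N..}. E i n))"
      by (simp add: set_eq_iff) (meson atLeast_iff)
    also have "\<dots> \<in> sets borel"
      by (intro sets.Int cl sets.countable_INT'' sets.countable_UN' borel_comp E) auto
    finally show ?thesis .
  qed
  have "AE x in cube_measure. \<forall>i::nat. \<forall>\<^sub>F n in sequentially.
      \<forall>k\<in>{1..nat \<lfloor>(2 - 1 / real (Suc i)) * real n\<rfloor>}. x \<notin> return_set k (inverse \<Lambda> ^ n)"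
    unfolding AE_all_countable by (intro allI AE_no_early_return) (auto simp: field_simps)
  then have "AE x in cube_measure. Q (\<phi> x)"
    by (rule AE_mp) (simp add: Q_def \<phi>_def G_def abs_torus_in_image_iff periodic_return_set)
  then have "AE z in \<mu>. Q z"
    unfolding \<mu>_def by (subst AE_distr_iff[OF _ Q_sets]) simp_all
  then show ?thesis
  proof (rule AE_mp, intro AE_I2 impI)
    fix z assume Q: "Q z"
    obtain x where x: "abs_torus x = p z" using ex_abs_torus by blast
    then have z: "z = \<phi> x" using Q by (simp add: Q_def \<phi>_def)
    show "((\<lambda>r. real (return_time T (ball z r)) / (- ln r)) \<longlongrightarrow> 2 / ln \<Lambda>) (at_right 0)"
      unfolding z
    proof (rule return_time_limit)
      fix i
      show "\<forall>\<^sub>F n in sequentially. \<forall>k\<in>{1..nat \<lfloor>(2 - 1 / real (Suc i)) * real n\<rfloor>}. x \<notin> return_set k (inverse \<Lambda> ^ n)"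
        using Q by (simp add: Q_def G_def abs_torus_in_image_iff periodic_return_set flip: x)
    qed
  qed
qed

end

section \<open>Integral matrices\<close>

lemma eigenvalues_2:
  fixes M :: "int^2^2"
  shows "eigenvalues M = {z. z\<^sup>2 - of_int (M$1$1 + M$2$2) * z + of_int (det M) = 0}"
proof -
  define a b c d :: complex where "a = of_int (M$1$1)" and "b = of_int (M$1$2)"
    and "c = of_int (M$2$1)" and "d = of_int (M$2$2)"
  note abcd = a_def b_def c_def d_def
  have char_poly: "z\<^sup>2 - of_int (M$1$1 + M$2$2) * z + of_int (det M) = (z - a) * (z - d) - b * c" for z
    by (simp add: det_2 abcd power2_eq_square algebra_simps)
  have eig: "z \<in> eigenvalues M \<longleftrightarrow> (\<exists>v::complex^2. (v$1 \<noteq> 0 \<or> v$2 \<noteq> 0)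
      \<and> a * v$1 + b * v$2 = z * v$1 \<and> c * v$1 + d * v$2 = z * v$2)" for z
    by (simp add: eigenvalues_def vec_eq_iff forall_2 matrix_vector_mult_def sum_2 abcd map_matrix_def)
  have "z \<in> eigenvalues M \<longleftrightarrow> (z - a) * (z - d) - b * c = 0" for z
  proof
    assume "z \<in> eigenvalues M"
    then obtain v :: "complex^2" where v: "v$1 \<noteq> 0 \<or> v$2 \<noteq> 0"
      "a * v$1 + b * v$2 = z * v$1" "c * v$1 + d * v$2 = z * v$2"
      unfolding eig by blast
    have "((z - a) * (z - d) - b * c) * v$1 = 0" "((z - a) * (z - d) - b * c) * v$2 = 0"
      using v(2,3) by algebra+
    then show "(z - a) * (z - d) - b * c = 0" using v(1) by auto
  next
    assume *: "(z - a) * (z - d) - b * c = 0"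
    have "\<exists>x y. (x \<noteq> 0 \<or> y \<noteq> 0) \<and> a * x + b * y = z * x \<and> c * x + d * y = z * y"
    proof (cases "c = 0 \<and> b = 0")
      case True
      then have "z = a \<or> z = d" using * by auto
      then show ?thesis using True by (elim disjE) (rule exI[of _ 1], rule exI[of _ 0], simp, rule exI[of _ 0], rule exI[of _ 1], simp)
    next
      case False
      then consider "c \<noteq> 0" | "b \<noteq> 0" by blast
      then show ?thesis
      proof cases
        case 1
        have "a * (z - d) + b * c = z * (z - d)" using * by algebra
        then show ?thesis using 1 by (intro exI[of _ "z - d"] exI[of _ c]) (simp add: algebra_simps)
      next
        case 2
        have "c * b + d * (z - a) = z * (z - a)" using * by algebra
        then show ?thesis using 2 by (intro exI[of _ b] exI[of _ "z - a"]) (simp add: algebra_simps)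
      qed
    qed
    then obtain x y where "(x \<noteq> 0 \<or> y \<noteq> 0) \<and> a * x + b * y = z * x \<and> c * x + d * y = z * y" by blast
    then show "z \<in> eigenvalues M" unfolding eig by (intro exI[of _ "vector [x, y]"]) simp
  qed
  then show ?thesis using char_poly by auto
qed

lemma det_invertible_int:
  fixes M :: "int^'n^'n"
  assumes "invertible M"
  shows "\<bar>det M\<bar> = 1"
proof -
  obtain M' where "M ** M' = mat 1" using assms by (auto simp: invertible_def)
  then have "det M * det M' = 1" by (metis det_I det_mul)
  then show ?thesis by (metis abs_1 abs_zmult_eq_1)
qed

text \<open>The characteristic polynomial has coefficients \<open>1\<close>, \<open>- tr M\<close> and \<open>\<plusminus> 1\<close>. Non-real roots would be
  conjugate with product \<open>1\<close>, hence on the unit circle.\<close>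

lemma hyperbolic_eigenvalues:
  fixes M :: "int^2^2"
  assumes M: "hyperbolic M"
  obtains \<alpha> \<beta> :: real where "1 < \<bar>\<alpha>\<bar>" "\<bar>\<alpha> * \<beta>\<bar> = 1"
    "\<alpha> + \<beta> = of_int (M$1$1 + M$2$2)" "\<alpha> * \<beta> = of_int (det M)"
    "eigenvalues M = {of_real \<alpha>, of_real \<beta>}"
proof -
  define t d :: real where "t = of_int (M$1$1 + M$2$2)" and "d = of_int (det M)"
  have ev: "eigenvalues M = {z. z\<^sup>2 - of_real t * z + of_real d = 0}"
    by (simp add: eigenvalues_2 t_def d_def)
  have unit: "cmod z \<noteq> 1" if "z\<^sup>2 - of_real t * z + of_real d = 0" for z
    using M that unfolding hyperbolic_def ev by blast
  have d: "\<bar>d\<bar> = 1"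
    using det_invertible_int[of M] M unfolding hyperbolic_def d_def by linarith
  have disc: "0 \<le> t\<^sup>2 - 4 * d"
  proof (rule ccontr)
    assume neg: "\<not> 0 \<le> t\<^sup>2 - 4 * d"
    define y where "y = sqrt (4 * d - t\<^sup>2) / 2"
    have y: "y\<^sup>2 = d - t\<^sup>2 / 4" using neg by (simp add: y_def power_divide)
    have "(Complex (t / 2) y)\<^sup>2 - of_real t * Complex (t / 2) y + of_real d = 0"
      using y by (simp add: complex_eq_iff power2_eq_square field_simps)
    moreover have "cmod (Complex (t / 2) y) = 1"
    proof -
      have "d = 1" using neg d zero_le_power2[of t] by linarith
      then have "(t / 2)\<^sup>2 + y\<^sup>2 = 1" using y by (simp add: power_divide)
      then show ?thesis by (simp add: cmod_def)
    qed
    ultimately show False using unit by blast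
  qed
  define a b where "a = (t + sqrt (t\<^sup>2 - 4 * d)) / 2" and "b = (t - sqrt (t\<^sup>2 - 4 * d)) / 2"
  have sum: "a + b = t" by (simp add: a_def b_def field_simps)
  have prod: "a * b = d"
  proof -
    have "a * b = (t\<^sup>2 - (sqrt (t\<^sup>2 - 4 * d))\<^sup>2) / 4"
      by (simp add: a_def b_def power2_eq_square algebra_simps)
    then show ?thesis using disc by simp
  qed
  have ev_eq: "eigenvalues M = {of_real x, of_real y}" if "x + y = t" "x * y = d" for x y :: real
  proof -
    have "z\<^sup>2 - of_real t * z + of_real d = (z - of_real x) * (z - of_real y)" for z :: complex
      by (simp flip: that add: power2_eq_square algebra_simps)
    then show ?thesis unfolding ev by auto
  qed
  have "of_real a \<in> eigenvalues M" using ev_eq[OF sum prod] by simp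
  then have a1: "\<bar>a\<bar> \<noteq> 1" using M unfolding hyperbolic_def by (metis norm_of_real)
  have ab: "\<bar>a\<bar> * \<bar>b\<bar> = 1" using prod d by (simp flip: abs_mult)
  show thesis
  proof (cases "\<bar>a\<bar> > 1")
    case True
    then show ?thesis using that[of a b] sum prod ev_eq[OF sum prod] d by (simp add: t_def d_def)
  next
    case False
    then have "\<bar>a\<bar> < 1" using a1 by linarith
    then have "\<bar>b\<bar> > 1"
      using ab mult_le_one[of "\<bar>a\<bar>" "\<bar>b\<bar>"] by (smt (verit) mult_left_le abs_ge_zero)
    then show ?thesis
      using that[of b a] sum prod ev_eq[of b a] d by (simp add: t_def d_def add.commute mult.commute)
  qed
qed

lemma hyperbolic_entry_nonzero:
  fixes M :: "int^2^2"
  assumes M: "hyperbolic M"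
  shows "M$2$1 \<noteq> 0"
proof
  assume 0: "M$2$1 = 0"
  have "\<bar>M$1$1 * M$2$2\<bar> = 1"
    using det_invertible_int[of M] M 0 by (simp add: hyperbolic_def det_2)
  then have "\<bar>M$1$1\<bar> = 1" by (metis abs_zmult_eq_1)
  moreover have "(of_int (M$1$1) :: complex) \<in> eigenvalues M"
    unfolding eigenvalues_2 using 0 by (simp add: det_2 power2_eq_square algebra_simps)
  ultimately show False using M unfolding hyperbolic_def
    by (metis norm_of_int of_int_abs of_int_1)
qed

lemma map_matrix_of_int_mult:
  fixes A B :: "int^'n^'n"
  shows "map_matrix real_of_int (A ** B) = map_matrix real_of_int A ** map_matrix real_of_int B"
  by (simp add: vec_eq_iff map_matrix_def matrix_matrix_mult_def)

lemma map_matrix_of_int_lattice: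
  fixes A :: "int^'n^'n"
  shows "(\<lambda>x. map_matrix real_of_int A *v x) ` int_lattice \<subseteq> int_lattice"
  by (auto simp: int_lattice_def matrix_vector_mult_def map_matrix_def intro!: Ints_sum Ints_mult)

lemma hyperbolic_lattice_map_matrix:
  fixes M :: "int^2^2"
  assumes M: "hyperbolic M"
  obtains g u s \<alpha> \<beta> K where "hyperbolic_lattice_map (\<lambda>x. map_matrix real_of_int M *v x) g u s \<alpha> \<beta> K"
    "eigenvalues M = {of_real \<alpha>, of_real \<beta>}"
proof -
  obtain \<alpha> \<beta> :: real where ab: "1 < \<bar>\<alpha>\<bar>" "\<bar>\<alpha> * \<beta>\<bar> = 1"
    "\<alpha> + \<beta> = of_int (M$1$1 + M$2$2)" "\<alpha> * \<beta> = of_int (det M)"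
    "eigenvalues M = {of_real \<alpha>, of_real \<beta>}"
    using hyperbolic_eigenvalues[OF M] .
  obtain M' where M': "M ** M' = mat 1" "M' ** M = mat 1"
    using M unfolding hyperbolic_def invertible_def by blast
  have id: "map_matrix real_of_int (mat 1 :: int^2^2) = mat 1"
    by (simp add: vec_eq_iff map_matrix_def mat_def)
  define a b c d :: real where "a = of_int (M$1$1)" and "b = of_int (M$1$2)"
    and "c = of_int (M$2$1)" and "d = of_int (M$2$2)"
  note abcd = a_def b_def c_def d_def
  have c: "c \<noteq> 0" using hyperbolic_entry_nonzero[OF M] by (simp add: c_def)
  have tr: "\<alpha> + \<beta> = a + d" using ab by (simp add: abcd)
  have det: "\<alpha> * \<beta> = a * d - b * c" using ab by (simp add: abcd det_2)
  have ne: "\<alpha> \<noteq> \<beta>"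
  proof
    assume "\<alpha> = \<beta>"
    then have "\<bar>\<alpha>\<bar> * \<bar>\<alpha>\<bar> = 1" using ab(2) by (simp add: abs_mult)
    moreover have "1 < \<bar>\<alpha>\<bar> * \<bar>\<alpha>\<bar>" using ab(1) by (rule less_1_mult[OF _ ab(1)])
    ultimately show False by simp
  qed
  let ?f = "\<lambda>x. map_matrix real_of_int M *v x"
  let ?g = "\<lambda>x. map_matrix real_of_int M' *v x"
  have f: "?f x $ 1 = a * x$1 + b * x$2" "?f x $ 2 = c * x$1 + d * x$2" for x
    by (simp_all add: matrix_vector_mult_def sum_2 abcd map_matrix_def)
  \<comment> \<open>The left eigenvectors, for \<open>\<alpha>\<close> and \<open>\<beta>\<close>.\<close>
  define u s :: "real^2 \<Rightarrow> real" where "u x = c * x$1 + (\<alpha> - a) * x$2" and "s x = c * x$1 + (\<beta> - a) * x$2" for x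
  have lin: "linear u" "linear s"
    unfolding u_def s_def by (auto intro!: linearI simp: algebra_simps)
  obtain Ku where Ku: "Ku > 0" "\<And>x. norm (u x) \<le> Ku * norm x" using linear_bounded_pos[OF lin(1)] by blast
  obtain Ks where Ks: "Ks > 0" "\<And>x. norm (s x) \<le> Ks * norm x" using linear_bounded_pos[OF lin(2)] by blast
  \<comment> \<open>The dual basis, consisting of right eigenvectors.\<close>
  define p q :: "real^2" where "p = vector [(a - \<beta>) / (c * (\<alpha> - \<beta>)), 1 / (\<alpha> - \<beta>)]"
    and "q = vector [(\<alpha> - a) / (c * (\<alpha> - \<beta>)), - 1 / (\<alpha> - \<beta>)]"
  have ne': "\<alpha> - \<beta> \<noteq> 0" using ne by simp
  have pq: "u p = 1" "s p = 0" "u q = 0" "s q = 1"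
    using c ne' by (simp_all add: u_def s_def p_def q_def divide_simps) (simp_all add: algebra_simps)?
  have split: "x = u x *\<^sub>R p + s x *\<^sub>R q" for x
  proof -
    have "u x - s x = (\<alpha> - \<beta>) * x$2" by (simp add: u_def s_def algebra_simps)
    then have x2: "u x / (\<alpha> - \<beta>) - s x / (\<alpha> - \<beta>) = x$2"
      using ne' by (simp add: divide_simps)
    have "(a - \<beta>) * u x + (\<alpha> - a) * s x = c * (\<alpha> - \<beta>) * x$1"
      by (simp add: u_def s_def algebra_simps)
    then have x1: "u x * ((a - \<beta>) / (c * (\<alpha> - \<beta>))) + s x * ((\<alpha> - a) / (c * (\<alpha> - \<beta>))) = x$1"
      using ne' c by (simp add: add_divide_distrib[symmetric] divide_simps mult.commute)
    show ?thesis using x1 x2 by (simp add: vec_eq_iff forall_2 p_def q_def)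
  qed
  define K where "K = Ku + Ks + norm p + norm q"
  have K: "K > 0" "Ku \<le> K" "Ks \<le> K" "norm p \<le> K" "norm q \<le> K"
    using Ku Ks norm_ge_zero[of p] norm_ge_zero[of q] unfolding K_def by linarith+
  have "hyperbolic_lattice_map ?f ?g u s \<alpha> \<beta> K"
  proof (rule hyperbolic_lattice_map.intro)
    show "linear ?f" "linear ?g" by (rule matrix_vector_mul_linear)+
    show "?f ` int_lattice \<subseteq> int_lattice" "?g ` int_lattice \<subseteq> int_lattice"
      by (rule map_matrix_of_int_lattice)+
    show "?f (?g x) = x" "?g (?f x) = x" for x
      by (simp_all add: matrix_vector_mul_assoc id M' flip: map_matrix_of_int_mult)
    show "u (?f x) = \<alpha> * u x" for x
    proof -
      have "b * c = \<alpha> * (a + d - \<alpha>) * (-1) + a * d" using tr det by algebra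
      then have "c * b + (\<alpha> - a) * d = \<alpha> * (\<alpha> - a)" by algebra
      moreover have "u (?f x) = \<alpha> * (c * x$1) + (c * b + (\<alpha> - a) * d) * x$2"
        unfolding u_def f by (simp add: algebra_simps)
      ultimately have "u (?f x) = \<alpha> * (c * x$1) + \<alpha> * (\<alpha> - a) * x$2" by simp
      then show ?thesis by (simp add: u_def[of x] algebra_simps)
    qed
    show "s (?f x) = \<beta> * s x" for x
    proof -
      have "b * c = \<beta> * (a + d - \<beta>) * (-1) + a * d" using tr det by algebra
      then have "c * b + (\<beta> - a) * d = \<beta> * (\<beta> - a)" by algebra
      moreover have "s (?f x) = \<beta> * (c * x$1) + (c * b + (\<beta> - a) * d) * x$2"
        unfolding s_def f by (simp add: algebra_simps)
      ultimately have "s (?f x) = \<beta> * (c * x$1) + \<beta> * (\<beta> - a) * x$2" by simp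
      then show ?thesis by (simp add: s_def[of x] algebra_simps)
    qed
    show "\<bar>u x\<bar> \<le> K * norm x" "\<bar>s x\<bar> \<le> K * norm x" for x
      using Ku(2)[of x] Ks(2)[of x] mult_right_mono[OF K(2), of "norm x"] mult_right_mono[OF K(3), of "norm x"] by auto
    show "norm x \<le> K * (\<bar>u x\<bar> + \<bar>s x\<bar>)" for x
    proof -
      have "norm x \<le> \<bar>u x\<bar> * norm p + \<bar>s x\<bar> * norm q"
        using norm_triangle_ineq[of "u x *\<^sub>R p" "s x *\<^sub>R q"] by (simp flip: split)
      also have "\<dots> \<le> \<bar>u x\<bar> * K + \<bar>s x\<bar> * K" using K by (intro add_mono mult_left_mono) auto
      finally show ?thesis by (simp add: algebra_simps)
    qed
    show "\<exists>v w. x = v + w \<and> s v = 0 \<and> u w = 0" for x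
      using split[of x] pq by (intro exI[of _ "u x *\<^sub>R p"] exI[of _ "s x *\<^sub>R q"]) (simp add: linear_cmul lin)
  qed (use ab lin K in auto)
  then show thesis using ab(5) that by blast
qed

lemma sum_UNIV_Plus:
  fixes F :: "'a::finite + 'b::finite \<Rightarrow> 'c::comm_monoid_add"
  shows "sum F UNIV = (\<Sum>i\<in>UNIV. F (Inl i)) + (\<Sum>j\<in>UNIV. F (Inr j))"
  unfolding UNIV_sum by (subst sum.union_disjoint) (auto simp: sum.reindex)

lemma eigenvalues_block_diag:
  "eigenvalues (block_diag M N) = eigenvalues M \<union> eigenvalues N"
proof -
  have inl: "(map_matrix of_int (block_diag M N) *v v) $ Inl i
      = (map_matrix of_int M *v (\<chi> k. v $ Inl k)) $ i" for v :: "complex^('a + 'b)" and i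
    by (simp add: matrix_vector_mult_def map_matrix_def block_diag_def sum_UNIV_Plus)
  have inr: "(map_matrix of_int (block_diag M N) *v v) $ Inr i
      = (map_matrix of_int N *v (\<chi> k. v $ Inr k)) $ i" for v :: "complex^('a + 'b)" and i
    by (simp add: matrix_vector_mult_def map_matrix_def block_diag_def sum_UNIV_Plus)
  have iff: "map_matrix of_int (block_diag M N) *v v = z *s v \<longleftrightarrow>
      map_matrix of_int M *v (\<chi> k. v $ Inl k) = z *s (\<chi> k. v $ Inl k)
      \<and> map_matrix of_int N *v (\<chi> k. v $ Inr k) = z *s (\<chi> k. v $ Inr k)" for v :: "complex^('a + 'b)" and z
    by (simp add: vec_eq_iff[of "map_matrix of_int (block_diag M N) *v v"] split_sum_all inl inr)
      (simp add: vec_eq_iff)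
  show ?thesis
  proof (intro equalityI subsetI)
    fix z assume "z \<in> eigenvalues (block_diag M N)"
    then obtain v :: "complex^('a + 'b)" where v: "v \<noteq> 0" "map_matrix of_int (block_diag M N) *v v = z *s v"
      by (auto simp: eigenvalues_def)
    have "(\<chi> k. v $ Inl k) \<noteq> 0 \<or> (\<chi> k. v $ Inr k) \<noteq> 0"
      using v(1) by (auto simp: vec_eq_iff split_sum_ex)
    then show "z \<in> eigenvalues M \<union> eigenvalues N" using v(2) unfolding iff eigenvalues_def by blast
  next
    fix z assume "z \<in> eigenvalues M \<union> eigenvalues N"
    then show "z \<in> eigenvalues (block_diag M N)"
    proof
      assume "z \<in> eigenvalues M"
      then obtain v where v: "v \<noteq> 0" "map_matrix of_int M *v v = z *s v" by (auto simp: eigenvalues_def)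
      define w :: "complex^('a + 'b)" where "w = (\<chi> i. case i of Inl k \<Rightarrow> v $ k | Inr _ \<Rightarrow> 0)"
      have w: "(\<chi> k. w $ Inl k) = v" "(\<chi> k. w $ Inr k) = 0" by (simp_all add: w_def vec_eq_iff)
      have "w \<noteq> 0"
      proof
        assume "w = 0"
        from w(1)[unfolded this] have "v = 0" by (auto simp: vec_eq_iff)
        with v(1) show False by simp
      qed
      moreover have "map_matrix of_int (block_diag M N) *v w = z *s w"
        unfolding iff w using v(2) by simp
      ultimately show ?thesis by (auto simp: eigenvalues_def)
    next
      assume "z \<in> eigenvalues N"
      then obtain v where v: "v \<noteq> 0" "map_matrix of_int N *v v = z *s v" by (auto simp: eigenvalues_def)
      define w :: "complex^('a + 'b)" where "w = (\<chi> i. case i of Inr k \<Rightarrow> v $ k | Inl _ \<Rightarrow> 0)"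
      have w: "(\<chi> k. w $ Inr k) = v" "(\<chi> k. w $ Inl k) = 0" by (simp_all add: w_def vec_eq_iff)
      have "w \<noteq> 0"
      proof
        assume "w = 0"
        from w(1)[unfolded this] have "v = 0" by (auto simp: vec_eq_iff)
        with v(1) show False by simp
      qed
      moreover have "map_matrix of_int (block_diag M N) *v w = z *s w"
        unfolding iff w using v(2) by simp
      ultimately show ?thesis by (auto simp: eigenvalues_def)
    qed
  qed
qed

section \<open>The direct product\<close>

lemma (in hyperbolic_lattice_map) lyapunov_exponents_eq:
  assumes "eigenvalues M = {of_real \<alpha>, of_real \<beta>}"
  shows "lyapunov_exponents M = {ln \<Lambda>, - ln \<Lambda>}"
  using assms by (simp add: lyapunov_exponents_def abs_\<beta> ln_inverse)

lemma lyapunov_block_diag: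
  assumes M: "lyapunov_exponents M = {h, - h}" and N: "lyapunov_exponents N = {h', - h'}"
    and h: "0 \<le> h'" "h' \<le> h"
  shows "lyapunov_max (block_diag M N) = h" "lyapunov_min (block_diag M N) = - h"
    "lyapunov_max (block_diag N M) = h" "lyapunov_min (block_diag N M) = - h"
proof -
  have "lyapunov_exponents (block_diag M N) = {h, - h, h', - h'}"
    "lyapunov_exponents (block_diag N M) = {h, - h, h', - h'}"
    using M N unfolding lyapunov_exponents_def eigenvalues_block_diag image_Un by auto
  then show "lyapunov_max (block_diag M N) = h" "lyapunov_min (block_diag M N) = - h"
    "lyapunov_max (block_diag N M) = h" "lyapunov_min (block_diag N M) = - h"
    using h unfolding lyapunov_max_def lyapunov_min_def
    by (auto intro!: Max_eqI Min_eqI)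
qed

lemma torus_map_abs_torus: "torus_map M (abs_torus x) = abs_torus (map_matrix real_of_int M *v x)"
  by (rule torus_map.abs_eq)

lemma continuous_torus_map:
  fixes M :: "int^'n^'n"
  shows "continuous_on UNIV (torus_map M)"
  unfolding continuous_on_iff
proof (intro ballI allI impI)
  let ?f = "\<lambda>x. map_matrix real_of_int M *v x"
  fix X :: "'n torus" and \<epsilon> :: real assume "\<epsilon> > 0"
  obtain B where B: "B > 0" "\<And>x. norm (?f x) \<le> B * norm x"
    using linear_bounded_pos[OF matrix_vector_mul_linear] by blast
  obtain x where x: "X = abs_torus x" using ex_abs_torus by metis
  have "dist (torus_map M Y) (torus_map M X) < \<epsilon>" if Y: "dist Y X < \<epsilon> / B" for Y
  proof -
    obtain y where y: "Y = abs_torus y" using ex_abs_torus by metis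
    obtain m where m: "m \<in> int_lattice" "dist y (x + m) < \<epsilon> / B"
      using Y unfolding x y dist_abs_torus_less by blast
    have "dist (?f y) (?f x + ?f m) = norm (?f (y - (x + m)))"
      by (simp only: dist_norm matrix_vector_mult_diff_distrib matrix_vector_right_distrib)
    also have "\<dots> \<le> B * dist y (x + m)" unfolding dist_norm by (rule B(2))
    also have "\<dots> < \<epsilon>" using m(2) B(1) by (simp add: pos_less_divide_eq mult.commute)
    finally have "dist (?f y) (?f x + ?f m) < \<epsilon>" .
    moreover have "?f m \<in> int_lattice" using m(1) map_matrix_of_int_lattice by blast
    ultimately show ?thesis unfolding x y torus_map_abs_torus dist_abs_torus_less by blast
  qed
  then show "\<exists>d>0. \<forall>Y\<in>UNIV. dist Y X < d \<longrightarrow> dist (torus_map M Y) (torus_map M X) < \<epsilon>"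
    using \<open>\<epsilon> > 0\<close> B(1) by (intro exI[of _ "\<epsilon> / B"]) simp
qed

lemma continuous_map_prod:
  assumes "continuous_on UNIV f" "continuous_on UNIV g"
  shows "continuous_on UNIV (map_prod f g)"
  unfolding map_prod_def split_beta
  by (intro continuous_on_Pair continuous_on_compose2[OF assms(1)] continuous_on_compose2[OF assms(2)]
      continuous_on_fst continuous_on_snd continuous_on_id) auto

context embedded_torus_automorphism
begin

lemma exists_measure_with_return_rate:
  assumes "1 / lmax - 1 / lmin = 2 / ln \<Lambda>"
  shows "\<exists>\<mu> :: 'a measure. sets \<mu> = sets borel \<and> prob_space \<mu> \<and>
           invariant_measure \<mu> T \<and> ergodic_measure \<mu> T \<and> ks_entropy \<mu> T > 0 \<and>
           (AE x in \<mu>. ((\<lambda>r. real (return_time T (ball x r)) / (- ln r)) \<longlongrightarrow> 1 / lmax - 1 / lmin) (at_right 0))"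
  unfolding assms
  using sets_\<mu> prob_space_\<mu> invariant_\<mu> ergodic_\<mu> ks_entropy_\<mu> AE_return_time_limit by blast

end

theorem proposition4p2:
  fixes M1 M2 :: "int^2^2"
    and A1 A2 :: "2 torus \<Rightarrow> 2 torus"
    and A :: "2 torus \<times> 2 torus \<Rightarrow> 2 torus \<times> 2 torus"
  assumes "hyperbolic M1" and "A1 = torus_map M1"
    and "hyperbolic M2" and "A2 = torus_map M2"
    and "A = map_prod A1 A2"
  shows "\<exists>\<mu> :: (2 torus \<times> 2 torus) measure.
           sets \<mu> = sets borel \<and> prob_space \<mu> \<and>
           invariant_measure \<mu> A \<and> ergodic_measure \<mu> A \<and> ks_entropy \<mu> A > 0 \<and>
           (AE x in \<mu>.
              ((\<lambda>r. real (return_time A (ball x r)) / (- ln r)) \<longlongrightarrow>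
                 1 / lyapunov_max (block_diag M1 M2) - 1 / lyapunov_min (block_diag M1 M2))
              (at_right 0))"
proof -
  obtain g1 u1 s1 \<alpha>1 \<beta>1 K1 where 1: "hyperbolic_lattice_map (\<lambda>x. map_matrix real_of_int M1 *v x) g1 u1 s1 \<alpha>1 \<beta>1 K1"
    "eigenvalues M1 = {of_real \<alpha>1, of_real \<beta>1}"
    using hyperbolic_lattice_map_matrix[OF assms(1)] .
  obtain g2 u2 s2 \<alpha>2 \<beta>2 K2 where 2: "hyperbolic_lattice_map (\<lambda>x. map_matrix real_of_int M2 *v x) g2 u2 s2 \<alpha>2 \<beta>2 K2"
    "eigenvalues M2 = {of_real \<alpha>2, of_real \<beta>2}"
    using hyperbolic_lattice_map_matrix[OF assms(3)] .
  define h1 h2 where "h1 = ln \<bar>\<alpha>1\<bar>" and "h2 = ln \<bar>\<alpha>2\<bar>"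
  have h: "0 < h1" "0 < h2"
    using hyperbolic_lattice_map.\<alpha>_gt_1[OF 1(1)] hyperbolic_lattice_map.\<alpha>_gt_1[OF 2(1)] by (simp_all add: h1_def h2_def)
  have l1: "lyapunov_exponents M1 = {h1, - h1}" and l2: "lyapunov_exponents M2 = {h2, - h2}"
    unfolding h1_def h2_def
    by (rule hyperbolic_lattice_map.lyapunov_exponents_eq[OF 1] hyperbolic_lattice_map.lyapunov_exponents_eq[OF 2])+
  have cont: "continuous_on UNIV A"
    unfolding assms by (intro continuous_map_prod continuous_torus_map)
  have comp: "compact (UNIV :: (2 torus \<times> 2 torus) set)"
    using compact_Times[OF compact_UNIV_torus compact_UNIV_torus] by simp
  show ?thesis
  proof (cases "h2 \<le> h1")
    case True
    interpret E: embedded_torus_automorphism "\<lambda>x. map_matrix real_of_int M1 *v x" g1 u1 s1 \<alpha>1 \<beta>1 K1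
      A1 A "\<lambda>X. (X, abs_torus 0)" fst
    proof (rule embedded_torus_automorphism.intro[OF 1(1)], rule embedded_torus_automorphism_axioms.intro)
    qed (simp_all add: assms(2,4,5) torus_map_abs_torus dist_Pair_Pair dist_fst_le cont[unfolded assms] comp)
    show ?thesis
      using lyapunov_block_diag(1,2)[OF l1 l2] h True by (intro E.exists_measure_with_return_rate) (simp add: h1_def)
  next
    case False
    interpret E: embedded_torus_automorphism "\<lambda>x. map_matrix real_of_int M2 *v x" g2 u2 s2 \<alpha>2 \<beta>2 K2
      A2 A "\<lambda>X. (abs_torus 0, X)" snd
    proof (rule embedded_torus_automorphism.intro[OF 2(1)], rule embedded_torus_automorphism_axioms.intro)
    qed (simp_all add: assms(2,4,5) torus_map_abs_torus dist_Pair_Pair dist_snd_le cont[unfolded assms] comp)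
    show ?thesis
      using lyapunov_block_diag(3,4)[OF l2 l1] h False by (intro E.exists_measure_with_return_rate) (simp add: h2_def)
  qed
qed

end
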